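(* Let $R$ be a principal ideal domain with field of fractions $F$. Let $A\in M_{m,n}(R)$ have rank $r$ with $0<r<n$, let $f=n-r$, and let $S=\{X\in R^n : AX=0\}$ be the nullspace of $A$ in $R^n$. Let $Z=\begin{pmatrix} dI_r & K\\ 0&0\end{pmatrix}\in M_{m,n}(R)$, with $0\neq d\in R$ and $K\in M_{r,f}(R)$, be a reduced matrix associated to $A$, say $LA\Sigma=Z$ with $L\in \mathrm{GL}_m(F)$ and $\Sigma\in\mathrm{GL}_n(F)$ a permutation matrix. Let $W\subseteq F^n$ be the free $R$-module of rank $f$ with basis $V(1),\dots,V(f)$, let $N$ be the nullspace of $J=(dI_r\ \ K)$ in $R^n$ (these are defined in the context), and set $U=\Sigma W$ and $M=dU$. Let $t$ be the rank of $K$, let $q_1\mid\cdots\mid q_t$ be the nonzero diagonal entries of the Smith normal form of $K$ (if $t=0$ there are none), and set $m_i=\mathrm{lcm}(d,q_i)/q_i$ and $d_i=d/\gcd(d,q_i)$ for $1\le i\le t$. Then $M\subseteq S\subseteq U$, and there are isomorphisms of $R$-modules $$U/S\cong W/N\cong R/Rm_t\oplus\cdots\oplus R/Rm_1\cong R/Rd_t\oplus\cdots\oplus R/Rd_1,$$ $$S/M\cong N/dW\cong R/R\gcd(d,q_1)\oplus\cdots\oplus R/R\gcd(d,q_t)\oplus (R/Rd)^{f-t}.$$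
   Context: A matrix $Z\in M_{m,n}(R)$ of rank $r$ is reduced if there are $0\ne d\in R$ and $K\in M_{r,f}(R)$, $f=n-r$, such that $Z=\begin{pmatrix} dI_r & K\\ 0&0\end{pmatrix}$ (the last $m-r$ rows are zero). Two matrices $B,C\in M_{m,n}(R)$ are associated if there are $L\in\mathrm{GL}_m(F)$ and a permutation matrix $\Sigma\in\mathrm{GL}_n(F)$ with $LB\Sigma=C$. Given a reduced $Z$, let $J=(dI_r\ \ K)\in M_{r,n}(R)$ and $N=\{X\in R^n: JX=0\}$. For $1\le j\le f$, $V(j)\in F^n$ is the column vector whose first $r$ entries are $-K_{1,j}/d,\dots,-K_{r,j}/d$, whose $(r+j)$-th entry is $1$, and whose other entries are $0$. Let $W=\mathrm{span}_R\{V(1),\dots,V(f)\}$, so that $dW\subseteq N\subseteq W$. Gcd's, lcm's and Smith normal form entries are determined up to multiplication by units of $R$. Empty direct sums are zero. *)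

theory Defs
  imports
    "HOL-Algebra.Ring_Divisibility"
    "HOL-Computational_Algebra.Polynomial_Factorial"
    "HOL-Combinatorics.Permutations"
    "Jordan_Normal_Form.DL_Rank"
    "Jordan_Normal_Form.Matrix_Kernel"
begin

text \<open>The quotient of a module \<open>P\<close> by a submodule \<open>H\<close>; its elements are the cosets of \<open>H\<close>.  The ring
  multiplication fields of a \<^type>\<open>module_ext\<close> record play no role for modules.\<close>

definition quot_module :: "('r, 'b) module \<Rightarrow> 'b set \<Rightarrow> ('r, 'b set) module" where
  "quot_module P H = \<lparr>
     carrier = a_rcosets\<^bsub>P\<^esub> H,
     mult = undefined,
     one = undefined,
     zero = H,
     add = set_add P,
     smult = (\<lambda>a C. \<Union>x\<in>C. H +>\<^bsub>P\<^esub> (a \<odot>\<^bsub>P\<^esub> x))\<rparr>"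

lemma module_quot_module:
  assumes P: "Module.module R P" and H: "Module.submodule H R P"
  shows "Module.module R (quot_module P H)"
proof -
  interpret P: Module.module R P by (fact P)
  interpret H: Module.submodule H R P by (fact H)
  interpret abelian_subgroup H P
    by (rule abelian_subgroupI3)
       (simp_all add: additive_subgroup_def H.subgroup_axioms P.abelian_group_axioms)
  have sc: "(\<Union>y\<in>H +>\<^bsub>P\<^esub> x. H +>\<^bsub>P\<^esub> (a \<odot>\<^bsub>P\<^esub> y)) = H +>\<^bsub>P\<^esub> (a \<odot>\<^bsub>P\<^esub> x)"
    if a: "a \<in> carrier R" and x: "x \<in> carrier P" for a x
  proof -
    have "H +>\<^bsub>P\<^esub> (a \<odot>\<^bsub>P\<^esub> y) = H +>\<^bsub>P\<^esub> (a \<odot>\<^bsub>P\<^esub> x)" if y: "y \<in> H +>\<^bsub>P\<^esub> x" for y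
    proof -
      obtain h where h: "h \<in> H" "y = h \<oplus>\<^bsub>P\<^esub> x"
        using y by (auto simp: a_r_coset_def')
      have ah: "a \<odot>\<^bsub>P\<^esub> h \<in> H" using H.smult_closed[OF a h(1)] .
      have "a \<odot>\<^bsub>P\<^esub> y = a \<odot>\<^bsub>P\<^esub> h \<oplus>\<^bsub>P\<^esub> a \<odot>\<^bsub>P\<^esub> x"
        using h x a by (simp add: P.smult_r_distr)
      then have "a \<odot>\<^bsub>P\<^esub> y \<in> H +>\<^bsub>P\<^esub> (a \<odot>\<^bsub>P\<^esub> x)"
        using ah by (auto simp: a_r_coset_def')
      then show ?thesis using a x by (intro a_repr_independence'[symmetric]) auto
    qed
    moreover have "x \<in> H +>\<^bsub>P\<^esub> x" using x by (rule a_rcos_self)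
    then have "H +>\<^bsub>P\<^esub> x \<noteq> {}" by auto
    ultimately show ?thesis by (simp add: UN_constant cong: SUP_cong_simp)
  qed
  have el: "\<exists>x\<in>carrier P. C = H +>\<^bsub>P\<^esub> x" if "C \<in> a_rcosets\<^bsub>P\<^esub> H" for C
    using that by (auto simp: A_RCOSETS_def')
  have el': "H +>\<^bsub>P\<^esub> x \<in> a_rcosets\<^bsub>P\<^esub> H" if "x \<in> carrier P" for x
    using that by (auto simp: A_RCOSETS_def')
  have Hz: "H = H +>\<^bsub>P\<^esub> \<zero>\<^bsub>P\<^esub>"
    by (simp add: P.a_coset_add_zero a_subset)
  have ag: "abelian_group (quot_module P H)"
    apply (rule abelian_groupI; simp add: quot_module_def)
         apply (drule el, drule el, elim bexE, simp add: a_rcos_sum el')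
        apply (subst Hz, rule el', simp)
       apply (drule el, drule el, drule el, elim bexE, simp add: a_rcos_sum P.a_assoc)
      apply (drule el, drule el, elim bexE, simp add: a_rcos_sum P.a_comm)
     apply (rule rcosets_add_eq, assumption)
    subgoal for C
      apply (drule el, elim bexE)
      subgoal for x
        by (rule bexI[of _ "H +>\<^bsub>P\<^esub> (\<ominus>\<^bsub>P\<^esub> x)"])
           (simp_all add: a_rcos_sum el' P.l_neg Hz[symmetric])
      done
    done
  have q: "carrier (quot_module P H) = a_rcosets\<^bsub>P\<^esub> H" "add (quot_module P H) = set_add P"
    by (simp_all add: quot_module_def)
  have sm: "a \<odot>\<^bsub>quot_module P H\<^esub> (H +>\<^bsub>P\<^esub> x) = H +>\<^bsub>P\<^esub> (a \<odot>\<^bsub>P\<^esub> x)"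
    if "a \<in> carrier R" and "x \<in> carrier P" for a x
    using sc[OF that] by (simp add: quot_module_def)
  show ?thesis
    apply (rule moduleI[OF P.R.is_cring ag]; unfold q)
        apply (drule el, elim bexE, simp add: sm el')
       apply (drule el, elim bexE, simp add: sm a_rcos_sum P.smult_l_distr)
      apply (drule el, drule el, elim bexE, simp add: sm a_rcos_sum P.smult_r_distr)
     apply (drule el, elim bexE, simp add: sm P.smult_assoc1)
    apply (drule el, elim bexE, simp add: sm)
    done
qed

definition direct_sum_list :: "('r, 'b) module list \<Rightarrow> ('r, 'b list) module" where
  "direct_sum_list Ps = \<lparr>
     carrier = {xs. list_all2 (\<lambda>x P. x \<in> carrier P) xs Ps},
     mult = undefined,
     one = undefined,
     zero = map (\<lambda>P. \<zero>\<^bsub>P\<^esub>) Ps,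
     add = (\<lambda>xs ys. map (\<lambda>i. xs ! i \<oplus>\<^bsub>Ps ! i\<^esub> ys ! i) [0..<length Ps]),
     smult = (\<lambda>a xs. map (\<lambda>i. a \<odot>\<^bsub>Ps ! i\<^esub> xs ! i) [0..<length Ps])\<rparr>"

lemma module_direct_sum_list:
  assumes R: "cring R" and Ps: "\<And>P. P \<in> set Ps \<Longrightarrow> Module.module R P"
  shows "Module.module R (direct_sum_list Ps)"
proof -
  have m: "Module.module R (Ps ! i)" if "i < length Ps" for i
    using that Ps by simp
  have ag: "abelian_group (Ps ! i)" if "i < length Ps" for i
    using m[OF that] by (rule Module.module.axioms(2))
  have am: "abelian_monoid (Ps ! i)" if "i < length Ps" for i
    using ag[OF that] by (rule abelian_group.axioms(1))
  have C: "xs \<in> carrier (direct_sum_list Ps) \<longleftrightarrow>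
      length xs = length Ps \<and> (\<forall>i<length Ps. xs ! i \<in> carrier (Ps ! i))" for xs
    by (auto simp: direct_sum_list_def list_all2_conv_all_nth)
  have Z: "\<zero>\<^bsub>direct_sum_list Ps\<^esub> = map (\<lambda>P. \<zero>\<^bsub>P\<^esub>) Ps"
    by (simp add: direct_sum_list_def)
  have Add: "xs \<oplus>\<^bsub>direct_sum_list Ps\<^esub> ys = map (\<lambda>i. xs ! i \<oplus>\<^bsub>Ps ! i\<^esub> ys ! i) [0..<length Ps]" for xs ys
    by (simp add: direct_sum_list_def)
  have Sm: "a \<odot>\<^bsub>direct_sum_list Ps\<^esub> xs = map (\<lambda>i. a \<odot>\<^bsub>Ps ! i\<^esub> xs ! i) [0..<length Ps]" for a xs
    by (simp add: direct_sum_list_def)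
  have ag_sum: "abelian_group (direct_sum_list Ps)"
  proof (rule abelian_groupI)
    fix xs assume xs: "xs \<in> carrier (direct_sum_list Ps)"
    let ?ys = "map (\<lambda>i. \<ominus>\<^bsub>Ps ! i\<^esub> (xs ! i)) [0..<length Ps]"
    have "?ys \<in> carrier (direct_sum_list Ps)"
      using xs by (simp add: C abelian_group.a_inv_closed[OF ag])
    moreover have "?ys \<oplus>\<^bsub>direct_sum_list Ps\<^esub> xs = \<zero>\<^bsub>direct_sum_list Ps\<^esub>"
      using xs by (intro nth_equalityI) (simp_all add: C Add Z abelian_group.l_neg[OF ag])
    ultimately show "\<exists>ys\<in>carrier (direct_sum_list Ps).
        ys \<oplus>\<^bsub>direct_sum_list Ps\<^esub> xs = \<zero>\<^bsub>direct_sum_list Ps\<^esub>" ..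
    show "\<zero>\<^bsub>direct_sum_list Ps\<^esub> \<oplus>\<^bsub>direct_sum_list Ps\<^esub> xs = xs"
      using xs by (intro nth_equalityI) (simp_all add: C Add Z abelian_monoid.l_zero[OF am])
    fix ys assume ys: "ys \<in> carrier (direct_sum_list Ps)"
    show "xs \<oplus>\<^bsub>direct_sum_list Ps\<^esub> ys \<in> carrier (direct_sum_list Ps)"
      using xs ys by (simp add: C Add abelian_monoid.a_closed[OF am])
    show "xs \<oplus>\<^bsub>direct_sum_list Ps\<^esub> ys = ys \<oplus>\<^bsub>direct_sum_list Ps\<^esub> xs"
      unfolding Add using xs ys by (intro map_cong refl abelian_monoid.a_comm[OF am]) (simp_all add: C)
    fix zs assume zs: "zs \<in> carrier (direct_sum_list Ps)"
    show "xs \<oplus>\<^bsub>direct_sum_list Ps\<^esub> ys \<oplus>\<^bsub>direct_sum_list Ps\<^esub> zs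
        = xs \<oplus>\<^bsub>direct_sum_list Ps\<^esub> (ys \<oplus>\<^bsub>direct_sum_list Ps\<^esub> zs)"
      unfolding Add using xs ys zs by (intro map_cong refl) (simp add: C abelian_monoid.a_assoc[OF am])
  qed (simp add: C Z abelian_monoid.zero_closed[OF am])
  show ?thesis
  proof (rule moduleI[OF R ag_sum])
    fix a xs assume a: "a \<in> carrier R" and xs: "xs \<in> carrier (direct_sum_list Ps)"
    show "a \<odot>\<^bsub>direct_sum_list Ps\<^esub> xs \<in> carrier (direct_sum_list Ps)"
      using a xs by (simp add: C Sm Module.module.smult_closed[OF m])
    fix b assume b: "b \<in> carrier R"
    show "(a \<oplus>\<^bsub>R\<^esub> b) \<odot>\<^bsub>direct_sum_list Ps\<^esub> xs
        = a \<odot>\<^bsub>direct_sum_list Ps\<^esub> xs \<oplus>\<^bsub>direct_sum_list Ps\<^esub> b \<odot>\<^bsub>direct_sum_list Ps\<^esub> xs"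
      unfolding Add Sm using a b xs
      by (intro map_cong refl) (simp add: C Module.module.smult_l_distr[OF m])
    show "(a \<otimes>\<^bsub>R\<^esub> b) \<odot>\<^bsub>direct_sum_list Ps\<^esub> xs
        = a \<odot>\<^bsub>direct_sum_list Ps\<^esub> (b \<odot>\<^bsub>direct_sum_list Ps\<^esub> xs)"
      unfolding Sm using a b xs
      by (intro map_cong refl) (simp add: C Module.module.smult_assoc1[OF m])
  next
    fix a xs ys assume a: "a \<in> carrier R"
      and xs: "xs \<in> carrier (direct_sum_list Ps)" and ys: "ys \<in> carrier (direct_sum_list Ps)"
    show "a \<odot>\<^bsub>direct_sum_list Ps\<^esub> (xs \<oplus>\<^bsub>direct_sum_list Ps\<^esub> ys)
        = a \<odot>\<^bsub>direct_sum_list Ps\<^esub> xs \<oplus>\<^bsub>direct_sum_list Ps\<^esub> a \<odot>\<^bsub>direct_sum_list Ps\<^esub> ys"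
      unfolding Add Sm using a xs ys
      by (intro map_cong refl) (simp add: C Module.module.smult_r_distr[OF m])
  next
    fix xs assume xs: "xs \<in> carrier (direct_sum_list Ps)"
    show "\<one>\<^bsub>R\<^esub> \<odot>\<^bsub>direct_sum_list Ps\<^esub> xs = xs"
      using xs by (intro nth_equalityI) (simp_all add: C Sm Module.module.smult_one[OF m])
  qed
qed

text \<open>\<^const>\<open>mod_hom\<close> includes the requirement that both arguments are \<open>R\<close>-modules.\<close>

definition module_isomorphic ::
  "('r, 'x) ring_scheme \<Rightarrow> ('r, 'b, 'y) module_scheme \<Rightarrow> ('r, 'c, 'z) module_scheme \<Rightarrow> bool" where
  "module_isomorphic R P Q \<longleftrightarrow>
     (\<exists>\<phi>. mod_hom R P Q \<phi> \<and> bij_betw \<phi> (carrier P) (carrier Q))"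

definition regular_module :: "('a::comm_ring_1, 'a) module" where
  "regular_module = \<lparr>carrier = UNIV, mult = (*), one = 1, zero = 0, add = (+), smult = (*)\<rparr>"

definition cyclic_module :: "'a::comm_ring_1 \<Rightarrow> ('a, 'a set) module" where
  "cyclic_module a = quot_module regular_module (PIdl\<^bsub>class_ring\<^esub> a)"

text \<open>\<open>F\<^sup>n\<close> as a module over \<open>R\<close>, where \<open>F\<close> is the field of fractions of \<open>R\<close>.\<close>

definition fract_vec_module :: "nat \<Rightarrow> ('a::idom, 'a fract vec) module" where
  "fract_vec_module n = \<lparr>
     carrier = carrier_vec n,
     mult = undefined,
     one = undefined,
     zero = 0\<^sub>v n,
     add = (+),
     smult = (\<lambda>a v. to_fract a \<cdot>\<^sub>v v)\<rparr>"

lemma cring_class_ring: "cring (class_ring :: 'a::comm_ring_1 ring)"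
  by (unfold_locales, unfold class_ring_simps)
     (auto simp: Units_def algebra_simps intro: exI[of _ "- _"])

lemma module_fract_vec_module: "Module.module (class_ring :: 'a::idom ring) (fract_vec_module n)"
proof (rule moduleI[OF cring_class_ring])
  show "abelian_group (fract_vec_module n :: ('a, 'a fract vec) module)"
  proof (rule abelian_groupI)
    fix x :: "'a fract vec"
    assume "x \<in> carrier (fract_vec_module n :: ('a, 'a fract vec) module)"
    then show "\<exists>y\<in>carrier (fract_vec_module n :: ('a, 'a fract vec) module).
        y \<oplus>\<^bsub>(fract_vec_module n :: ('a, 'a fract vec) module)\<^esub> x
        = \<zero>\<^bsub>(fract_vec_module n :: ('a, 'a fract vec) module)\<^esub>"
      by (intro bexI[of _ "- x"]) (auto simp: fract_vec_module_def)
  qed (auto simp: fract_vec_module_def)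
qed (auto simp: fract_vec_module_def add_smult_distrib_vec smult_add_distrib_vec smult_smult_assoc)

abbreviation sub_quot :: "nat \<Rightarrow> 'a::idom fract vec set \<Rightarrow> 'a fract vec set \<Rightarrow> ('a, 'a fract vec set) module" where
  "sub_quot n X Y \<equiv> quot_module ((fract_vec_module n)\<lparr>carrier := X\<rparr>) Y"

definition permutation_mat :: "nat \<Rightarrow> 'a::zero_neq_one mat \<Rightarrow> bool" where
  "permutation_mat n P \<longleftrightarrow>
     (\<exists>\<pi>. \<pi> permutes {..<n} \<and> P = mat n n (\<lambda>(i, j). if i = \<pi> j then 1 else 0))"

definition smith_normal_form :: "'a::comm_ring_1 mat \<Rightarrow> 'a mat \<Rightarrow> bool" where
  "smith_normal_form K D \<longleftrightarrow>
     D \<in> carrier_mat (dim_row K) (dim_col K) \<and> diagonal_mat D \<and>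
     (\<forall>i. Suc i < min (dim_row D) (dim_col D) \<longrightarrow> D $$ (i, i) dvd D $$ (Suc i, Suc i)) \<and>
     (\<exists>P Q. P \<in> carrier_mat (dim_row K) (dim_row K) \<and> invertible_mat P \<and>
            Q \<in> carrier_mat (dim_col K) (dim_col K) \<and> invertible_mat Q \<and> P * K * Q = D)"

definition nonzero_diagonal :: "'a::zero mat \<Rightarrow> 'a list" where
  "nonzero_diagonal D =
     filter (\<lambda>x. x \<noteq> 0) (map (\<lambda>i. D $$ (i, i)) [0..<min (dim_row D) (dim_col D)])"

text \<open>The nullspace of \<open>A\<close> in \<open>R\<^sup>n\<close>, embedded into \<open>F\<^sup>n\<close>.\<close>

definition nullspace :: "'a::idom mat \<Rightarrow> 'a fract vec set" where
  "nullspace A = map_vec to_fract ` mat_kernel A"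

text \<open>The block matrix with \<open>m\<close> rows whose first \<open>dim_row K\<close> rows are \<open>(d I  K)\<close> and whose other
  rows are zero.\<close>

definition reduced_mat :: "nat \<Rightarrow> 'a::idom \<Rightarrow> 'a mat \<Rightarrow> 'a mat" where
  "reduced_mat m d K =
     four_block_mat (d \<cdot>\<^sub>m 1\<^sub>m (dim_row K)) K
       (0\<^sub>m (m - dim_row K) (dim_row K)) (0\<^sub>m (m - dim_row K) (dim_col K))"

text \<open>The vectors \<open>V(1), \<dots>, V(f)\<close>, indexed from \<open>0\<close>.\<close>

definition V_vec :: "'a::idom \<Rightarrow> 'a mat \<Rightarrow> nat \<Rightarrow> 'a fract vec" where
  "V_vec d K j = vec (dim_row K + dim_col K)
     (\<lambda>i. if i < dim_row K then - to_fract (K $$ (i, j)) / to_fract d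
          else if i = dim_row K + j then 1 else 0)"

end

theory Submission
  imports Defs
begin

text \<open>The vectors of \<open>F\<^sup>n\<close> killed by \<open>J\<close> are the \<open>w(c) = (-Kc/d, c)\<close>, so \<open>W = w(R\<^sup>f)\<close>, while
  \<open>w(c) \<in> N\<close> iff \<open>d\<close> divides \<open>Kc\<close>.  If \<open>B K Q = D\<close> is the Smith normal form, then \<open>x \<mapsto> w(Qx)\<close> maps
  \<open>R\<^sup>f\<close> isomorphically onto \<open>W\<close>, and \<open>w(Qx) \<in> N\<close> iff \<open>d\<close> divides \<open>q\<^sub>i x\<^sub>i\<close>, that is iff \<open>d\<^sub>i\<close> (or \<open>m\<^sub>i\<close>)
  divides \<open>x\<^sub>i\<close>, for all \<open>i \<le> t\<close>.  Rescaling the first \<open>t\<close> coordinates by the \<open>d\<^sub>i\<close> parametrizes \<open>N\<close> in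
  the same way.  Since \<open>S = \<Sigma>N\<close>, all modules in question are images of \<open>R\<^sup>f\<close>, and two images of a module
  under homomorphisms with the same kernel are isomorphic.\<close>

section \<open>Homomorphisms onto quotients and subquotients\<close>

text \<open>By the homomorphism theorem both targets are \<open>E\<close> modulo the common kernel.
  The isomorphism sends \<open>\<phi> x\<close> to \<open>\<psi> x\<close>; it is written as
  \<open>\<psi>\<close> after a set-theoretic section \<open>g\<close> of \<open>\<phi>\<close>,
  which need not itself be additive.\<close>

lemma module_isomorphic_common_source:
  assumes \<phi>: "mod_hom R E P \<phi>" and \<psi>: "mod_hom R E Q \<psi>"
    and onto: "\<phi> ` carrier E = carrier P" "\<psi> ` carrier E = carrier Q"
    and ker: "\<And>x. x \<in> carrier E \<Longrightarrow> \<phi> x = \<zero>\<^bsub>P\<^esub> \<longleftrightarrow> \<psi> x = \<zero>\<^bsub>Q\<^esub>"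
  shows "module_isomorphic R P Q"
proof -
  interpret \<phi>: mod_hom R E P \<phi> by (rule \<phi>)
  interpret \<psi>: mod_hom R E Q \<psi> by (rule \<psi>)
  \<comment> \<open>Taking differences turns equal kernels into equal fibres. This yields both
    independence of the section and injectivity.\<close>
  have eq: "\<phi> x = \<phi> y \<longleftrightarrow> \<psi> x = \<psi> y" if "x \<in> carrier E" "y \<in> carrier E" for x y
    using ker[of "x \<ominus>\<^bsub>E\<^esub> y"] that by simp
  define g where "g p = inv_into (carrier E) \<phi> p" for p
  have gE: "g p \<in> carrier E" and \<phi>g: "\<phi> (g p) = p" if "p \<in> carrier P" for p
    using that unfolding g_def onto(1)[symmetric] by (auto intro: inv_into_into f_inv_into_f)
  have \<psi>g: "\<psi> (g (\<phi> x)) = \<psi> x" if "x \<in> carrier E" for x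
    using that eq[of "g (\<phi> x)" x] gE \<phi>g by simp
  have "mod_hom R P Q (\<psi> \<circ> g)"
  proof (intro mod_hom.intro mod_hom_axioms.intro)
    have "(\<psi> \<circ> g) (p \<oplus>\<^bsub>P\<^esub> p') = (\<psi> \<circ> g) p \<oplus>\<^bsub>Q\<^esub> (\<psi> \<circ> g) p'" if "p \<in> carrier P" "p' \<in> carrier P" for p p'
      using \<psi>g[of "g p \<oplus>\<^bsub>E\<^esub> g p'"] that by (simp add: gE \<phi>g)
    moreover have "(\<psi> \<circ> g) (a \<odot>\<^bsub>P\<^esub> p) = a \<odot>\<^bsub>Q\<^esub> (\<psi> \<circ> g) p" if "a \<in> carrier R" "p \<in> carrier P" for a p
      using \<psi>g[of "a \<odot>\<^bsub>E\<^esub> g p"] that by (simp add: gE \<phi>g)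
    ultimately show "\<psi> \<circ> g \<in> module_hom R P Q"
      by (auto simp: module_hom_def gE)
  qed (rule \<phi>.N.module_axioms \<psi>.N.module_axioms)+
  moreover have "inj_on (\<psi> \<circ> g) (carrier P)"
  proof (rule inj_onI)
    fix p p' assume p: "p \<in> carrier P" "p' \<in> carrier P" and "(\<psi> \<circ> g) p = (\<psi> \<circ> g) p'"
    then have "\<phi> (g p) = \<phi> (g p')" by (simp add: eq gE)
    with p show "p = p'" by (simp add: \<phi>g)
  qed
  moreover have "(\<psi> \<circ> g) ` carrier P = carrier Q"
  proof (intro equalityI subsetI)
    fix y assume "y \<in> carrier Q"
    then obtain x where "x \<in> carrier E" "y = \<psi> x" using onto(2) by blast
    then show "y \<in> (\<psi> \<circ> g) ` carrier P"
      by (intro image_eqI[of _ _ "\<phi> x"]) (simp_all add: \<psi>g)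
  qed (auto simp: gE)
  ultimately show ?thesis
    unfolding module_isomorphic_def bij_betw_def by blast
qed

text \<open>Being a submodule depends only on \<open>H\<close> and the inherited operations, not on
  the ambient carrier. Quotients can thus be formed inside a submodule of
  \<open>F^n\<close>.\<close>

lemma (in Module.module) submodule_of_submodule:
  assumes H: "Module.submodule H R M" and K: "Module.submodule K R M" and "H \<subseteq> K"
  shows "Module.submodule H R (M\<lparr>carrier := K\<rparr>)"
proof -
  have "Module.module R (M\<lparr>carrier := K\<rparr>\<lparr>carrier := H\<rparr>)"
    using Module.submodule.submodule_is_module[OF H module_axioms] by simp
  then show ?thesis
    using Module.module.module_incl_imp_submodule
      [OF Module.submodule.submodule_is_module[OF K module_axioms]] \<open>H \<subseteq> K\<close> by simp
qed

lemma mod_hom_quot_module: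
  assumes M: "Module.module R M" and H: "Module.submodule H R M"
  shows "mod_hom R M (quot_module M H) (\<lambda>x. H +>\<^bsub>M\<^esub> x)"
    and "(\<lambda>x. H +>\<^bsub>M\<^esub> x) ` carrier M = carrier (quot_module M H)"
    and "\<And>x. x \<in> carrier M \<Longrightarrow> H +>\<^bsub>M\<^esub> x = \<zero>\<^bsub>quot_module M H\<^esub> \<longleftrightarrow> x \<in> H"
proof -
  interpret M: Module.module R M by (rule M)
  interpret H: Module.submodule H R M by (rule H)
  interpret abelian_subgroup H M
    by (rule abelian_subgroupI3)
       (simp_all add: additive_subgroup_def H.subgroup_axioms M.abelian_group_axioms)
  interpret Q: Module.module R "quot_module M H"
    by (rule module_quot_module[OF M H])
  show surj: "(\<lambda>x. H +>\<^bsub>M\<^esub> x) ` carrier M = carrier (quot_module M H)"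
    by (auto simp: quot_module_def A_RCOSETS_def')
  \<comment> \<open>Scalar multiplication in \<open>quot_module\<close> is a union over all
    representatives of a coset. It collapses because every representative \<open>y\<close> of the
    coset of \<open>x\<close> gives the same coset of \<open>a y\<close>.\<close>
  have "H +>\<^bsub>M\<^esub> (a \<odot>\<^bsub>M\<^esub> x) = (\<Union>y\<in>H +>\<^bsub>M\<^esub> x. H +>\<^bsub>M\<^esub> (a \<odot>\<^bsub>M\<^esub> y))"
    if a: "a \<in> carrier R" and x: "x \<in> carrier M" for a x
  proof -
    have "H +>\<^bsub>M\<^esub> (a \<odot>\<^bsub>M\<^esub> y) = H +>\<^bsub>M\<^esub> (a \<odot>\<^bsub>M\<^esub> x)" if y: "y \<in> H +>\<^bsub>M\<^esub> x" for y
    proof -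
      obtain h where h: "h \<in> H" "y = h \<oplus>\<^bsub>M\<^esub> x"
        using y by (auto simp: a_r_coset_def')
      then have "a \<odot>\<^bsub>M\<^esub> y = a \<odot>\<^bsub>M\<^esub> h \<oplus>\<^bsub>M\<^esub> a \<odot>\<^bsub>M\<^esub> x"
        using x a by (simp add: M.smult_r_distr)
      then have "a \<odot>\<^bsub>M\<^esub> y \<in> H +>\<^bsub>M\<^esub> (a \<odot>\<^bsub>M\<^esub> x)"
        using H.smult_closed[OF a h(1)] by (auto simp: a_r_coset_def')
      then show ?thesis using a x by (intro a_repr_independence'[symmetric]) auto
    qed
    moreover have "x \<in> H +>\<^bsub>M\<^esub> x" using x by (rule a_rcos_self)
    ultimately show ?thesis by blast
  qed
  then show "mod_hom R M (quot_module M H) (\<lambda>x. H +>\<^bsub>M\<^esub> x)"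
    by (intro mod_hom.intro mod_hom_axioms.intro M Q.module_axioms)
       (auto simp: module_hom_def surj[symmetric], auto simp: quot_module_def a_rcos_sum)
  show "H +>\<^bsub>M\<^esub> x = \<zero>\<^bsub>quot_module M H\<^esub> \<longleftrightarrow> x \<in> H" if "x \<in> carrier M" for x
    using that a_rcos_const[of x] a_rcos_self[of x] by (auto simp: quot_module_def)
qed

lemma mod_hom_comp:
  assumes "mod_hom R E M f" "mod_hom R M Q g"
  shows "mod_hom R E Q (\<lambda>x. g (f x))"
proof -
  interpret f: mod_hom R E M f by (rule assms)
  interpret g: mod_hom R M Q g by (rule assms)
  show ?thesis by unfold_locales (auto simp: module_hom_def)
qed

lemma mod_hom_image_submodule:
  assumes "mod_hom R E M h"
  shows "Module.submodule (h ` carrier E) R M"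
proof -
  interpret mod_hom R E M h by (rule assms)
  show ?thesis
    by (rule N.module_incl_imp_submodule)
       (use N.submodule_is_module[OF im_is_submodule] in \<open>auto simp: im_def\<close>)
qed

text \<open>This is \<open>h\<close> followed by the projection of its image modulo
  \<open>Y\<close>, so the kernel is the preimage of \<open>Y\<close>. It presents a subquotient of
  \<open>M\<close> as an image of \<open>E\<close>.\<close>

lemma mod_hom_subquotient:
  assumes h: "mod_hom R E M h" and Y: "Module.submodule Y R M" and sub: "Y \<subseteq> h ` carrier E"
  defines "Q \<equiv> quot_module (M\<lparr>carrier := h ` carrier E\<rparr>) Y"
  shows "mod_hom R E Q (\<lambda>x. Y +>\<^bsub>M\<^esub> h x)"
    and "(\<lambda>x. Y +>\<^bsub>M\<^esub> h x) ` carrier E = carrier Q"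
    and "\<And>x. x \<in> carrier E \<Longrightarrow> Y +>\<^bsub>M\<^esub> h x = \<zero>\<^bsub>Q\<^esub> \<longleftrightarrow> h x \<in> Y"
proof -
  interpret h: mod_hom R E M h by (rule h)
  let ?X = "M\<lparr>carrier := h ` carrier E\<rparr>"
  note im = mod_hom_image_submodule[OF h]
  note X = Module.submodule.submodule_is_module[OF im h.N.module_axioms]
  have hX: "mod_hom R E ?X h"
    by (intro mod_hom.intro mod_hom_axioms.intro h.M.module_axioms X) (auto simp: module_hom_def)
  note q = mod_hom_quot_module[OF X h.N.submodule_of_submodule[OF Y im sub]]
  \<comment> \<open>A coset involves only the addition of \<open>M\<close>, so restricting the
    carrier does not change it.\<close>
  have c: "Y +>\<^bsub>?X\<^esub> x = Y +>\<^bsub>M\<^esub> x" for x by (simp add: a_r_coset_def r_coset_def)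
  show "mod_hom R E Q (\<lambda>x. Y +>\<^bsub>M\<^esub> h x)"
    using mod_hom_comp[OF hX q(1)] by (simp add: Q_def c)
  show "(\<lambda>x. Y +>\<^bsub>M\<^esub> h x) ` carrier E = carrier Q"
    using q(2) by (simp add: Q_def c image_image)
  show "Y +>\<^bsub>M\<^esub> h x = \<zero>\<^bsub>Q\<^esub> \<longleftrightarrow> h x \<in> Y" if "x \<in> carrier E" for x
    using q(3)[of "h x"] that by (simp add: Q_def c)
qed

text \<open>Both quotients are images of \<open>E\<close>, with kernels the preimages of
  \<open>Y\<close> and \<open>Y'\<close>, and \<open>eq\<close> makes these kernels equal.\<close>

lemma subquotients_isomorphic:
  assumes h: "mod_hom R E M h" "Module.submodule Y R M" "Y \<subseteq> h ` carrier E"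
    and k: "mod_hom R E M' k" "Module.submodule Y' R M'" "Y' \<subseteq> k ` carrier E"
    and eq: "\<And>x. x \<in> carrier E \<Longrightarrow> h x \<in> Y \<longleftrightarrow> k x \<in> Y'"
  shows "module_isomorphic R (quot_module (M\<lparr>carrier := h ` carrier E\<rparr>) Y)
           (quot_module (M'\<lparr>carrier := k ` carrier E\<rparr>) Y')"
  by (rule module_isomorphic_common_source
        [OF mod_hom_subquotient(1)[OF h] mod_hom_subquotient(1)[OF k]
            mod_hom_subquotient(2)[OF h] mod_hom_subquotient(2)[OF k]])
     (simp add: mod_hom_subquotient(3)[OF h] mod_hom_subquotient(3)[OF k] eq)

section \<open>Cyclic modules and their direct sums\<close>

lemma module_module_vec: "Module.module (class_ring :: 'a::comm_ring_1 ring) (module_vec TYPE('a) f)"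
proof -
  interpret vec_module "TYPE('a)" f .
  show ?thesis by (rule module_axioms)
qed

lemma module_regular_module: "Module.module (class_ring :: 'a::comm_ring_1 ring) regular_module"
proof (rule moduleI[OF cring_class_ring])
  show "abelian_group (regular_module :: ('a, 'a) module)"
    by (rule abelian_groupI)
       (auto simp: regular_module_def algebra_simps intro: exI[of _ "- _"])
qed (auto simp: regular_module_def algebra_simps)

lemma mod_hom_cyclic_module:
  fixes a :: "'a::comm_ring_1"
  defines "c \<equiv> \<lambda>x. PIdl\<^bsub>class_ring\<^esub> a +>\<^bsub>regular_module\<^esub> x"
  shows "mod_hom class_ring regular_module (cyclic_module a) c"
    and "c ` UNIV = carrier (cyclic_module a)"
    and "c x = \<zero>\<^bsub>cyclic_module a\<^esub> \<longleftrightarrow> a dvd x"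
proof -
  interpret Module.module "class_ring :: 'a ring" "regular_module :: ('a, 'a) module"
    by (rule module_regular_module)
  have min: "\<ominus>\<^bsub>regular_module\<^esub> x = - x" for x :: 'a
    by (rule minus_equality) (auto simp: regular_module_def)
  have PIdl: "x \<in> PIdl\<^bsub>class_ring\<^esub> a \<longleftrightarrow> a dvd x" for x
    by (auto simp: cgenideal_def dvd_def mult.commute)
  have sub: "Module.submodule (PIdl\<^bsub>class_ring\<^esub> a) class_ring regular_module"
    by (rule submoduleI) (auto simp: min PIdl, auto simp: regular_module_def PIdl)
  note q = mod_hom_quot_module[OF module_regular_module sub, folded cyclic_module_def]
  show "mod_hom class_ring regular_module (cyclic_module a) c"
    unfolding c_def by (rule q)
  show "c ` UNIV = carrier (cyclic_module a)"
    using q(2) by (simp add: c_def regular_module_def)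
  show "c x = \<zero>\<^bsub>cyclic_module a\<^esub> \<longleftrightarrow> a dvd x"
    using q(3)[of x] by (simp add: c_def regular_module_def PIdl)
qed

text \<open>Each listed coordinate is projected modulo its own \<open>a i\<close>, so the kernel is
  given by independent divisibility conditions. The list \<open>js\<close> selects the coordinates
  that count and fixes the order of the summands; its distinctness makes the projection
  surjective.\<close>

lemma mod_hom_direct_sum_cyclic:
  fixes a :: "nat \<Rightarrow> 'a::comm_ring_1"
  assumes js: "distinct js" "set js \<subseteq> {..<f}"
  defines "\<phi> \<equiv> \<lambda>x. map (\<lambda>i. PIdl\<^bsub>class_ring\<^esub> (a i) +>\<^bsub>regular_module\<^esub> (x $ i)) js"
    and "C \<equiv> direct_sum_list (map (\<lambda>i. cyclic_module (a i)) js)"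
  shows "mod_hom class_ring (module_vec TYPE('a) f) C \<phi>"
    and "\<phi> ` carrier_vec f = carrier C"
    and "\<phi> x = \<zero>\<^bsub>C\<^esub> \<longleftrightarrow> (\<forall>i\<in>set js. a i dvd x $ i)"
proof -
  let ?R = "class_ring :: 'a ring"
  have c: "Module.module ?R (cyclic_module b)" for b :: 'a
    using mod_hom_cyclic_module(1)[of b] by (simp add: mod_hom_def)
  have C: "Module.module ?R C"
    unfolding C_def by (rule module_direct_sum_list[OF cring_class_ring]) (auto simp: c)
  let ?c = "\<lambda>i x. PIdl\<^bsub>?R\<^esub> (a i) +>\<^bsub>regular_module\<^esub> x"
  have hom: "?c i \<in> module_hom ?R regular_module (cyclic_module (a i))" for i
    using mod_hom_cyclic_module(1)[of "a i"] by (simp add: mod_hom_def mod_hom_axioms_def)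
  have [simp]: "?c i (x + y) = ?c i x \<oplus>\<^bsub>cyclic_module (a i)\<^esub> ?c i y"
    "?c i (b * x) = b \<odot>\<^bsub>cyclic_module (a i)\<^esub> ?c i x" for i x y b
    using module_hom_add[OF hom, of x y i] module_hom_smult[OF hom, of b x i]
    by (simp_all add: regular_module_def)
  have [simp]: "?c i x \<in> carrier (cyclic_module (a i))" for i x
    using mod_hom_cyclic_module(2)[of "a i"] by blast
  have js_less: "js ! i < f" if "i < length js" for i
    using js(2) that nth_mem by blast
  have carr: "\<phi> x \<in> carrier C" for x
    by (simp add: C_def direct_sum_list_def \<phi>_def list_all2_conv_all_nth)
  show "mod_hom ?R (module_vec TYPE('a) f) C \<phi>"
  proof (intro mod_hom.intro mod_hom_axioms.intro module_module_vec C)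
    show "\<phi> \<in> module_hom ?R (module_vec TYPE('a) f) C"
      by (auto simp: module_hom_def module_vec_simps carr)
         (auto simp: C_def direct_sum_list_def \<phi>_def js_less intro!: nth_equalityI)
  qed
  show "\<phi> x = \<zero>\<^bsub>C\<^esub> \<longleftrightarrow> (\<forall>i\<in>set js. a i dvd x $ i)"
    by (simp add: \<phi>_def C_def direct_sum_list_def mod_hom_cyclic_module(3))
  show "\<phi> ` carrier_vec f = carrier C"
  proof (intro equalityI subsetI)
    fix ys assume ys: "ys \<in> carrier C"
    then have len: "length ys = length js"
      and y: "\<And>k. k < length js \<Longrightarrow> ys ! k \<in> carrier (cyclic_module (a (js ! k)))"
      by (auto simp: C_def direct_sum_list_def list_all2_conv_all_nth)
    have "\<exists>x. k < length js \<longrightarrow> ?c (js ! k) x = ys ! k" for k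
      using y[of k] unfolding mod_hom_cyclic_module(2)[symmetric] by blast
    then obtain z where z: "\<And>k. k < length js \<Longrightarrow> ?c (js ! k) (z k) = ys ! k" by metis
    \<comment> \<open>Coordinate \<open>i\<close> of the lift is the value chosen at the unique
      position of \<open>i\<close> in \<open>js\<close>. Coordinates outside \<open>js\<close> are
      arbitrary, as \<open>\<phi>\<close> ignores them.\<close>
    define x where "x = vec f (\<lambda>i. z (THE k. k < length js \<and> js ! k = i))"
    have "(THE l. l < length js \<and> js ! l = js ! k) = k" if "k < length js" for k
      using js(1) that by (auto simp: nth_eq_iff_index_eq)
    then have "\<phi> x = ys"
      by (intro nth_equalityI) (auto simp: \<phi>_def x_def js_less z len)
    then show "ys \<in> \<phi> ` carrier_vec f" by (auto simp: x_def)
  qed (use carr in auto)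
qed

section \<open>Ranks and the Smith normal form\<close>

text \<open>Meant for a Smith diagonal, where zeros propagate to the right because 0 divides only 0.
  Filtering then merely cuts the list off and shifts no index.\<close>

lemma filter_nonzero_prefix:
  assumes "\<And>i. Suc i < length xs \<Longrightarrow> xs ! i = 0 \<Longrightarrow> xs ! Suc i = 0"
  shows "\<exists>s\<le>length xs. filter (\<lambda>x. x \<noteq> 0) xs = take s xs \<and> (\<forall>i<s. xs ! i \<noteq> 0) \<and>
           (\<forall>i. s \<le> i \<and> i < length xs \<longrightarrow> xs ! i = 0)"
  using assms
proof (induction xs)
  case (Cons x xs)
  have step: "xs ! Suc i = 0" if "Suc i < length xs" "xs ! i = 0" for i
    using Cons.prems[of "Suc i"] that by simp
  show ?case
  proof (cases "x = 0")
    case True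
    have zero: "(x # xs) ! i = 0" if "i < length (x # xs)" for i
      using that by (induction i) (use True Cons.prems in auto)
    then have "\<forall>y\<in>set (x # xs). y = 0"
      by (metis in_set_conv_nth)
    then have "filter (\<lambda>x. x \<noteq> 0) (x # xs) = []"
      by (simp add: filter_empty_conv)
    with zero show ?thesis by (intro exI[of _ 0]) simp
  next
    case False
    obtain s where "s \<le> length xs" "filter (\<lambda>x. x \<noteq> 0) xs = take s xs"
      "\<forall>i<s. xs ! i \<noteq> 0" "\<forall>i. s \<le> i \<and> i < length xs \<longrightarrow> xs ! i = 0"
      using Cons.IH step by blast
    with False show ?thesis
      by (intro exI[of _ "Suc s"]) (auto simp: nth_Cons split: nat.splits)
  qed
qed simp

text \<open>Rank-nullity for the map \<open>v\<close> to \<open>A v\<close>, whose image is the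
  column space of \<open>A\<close>.\<close>

lemma rank_plus_kernel_dim:
  assumes A: "A \<in> carrier_mat nr nc"
  shows "vec_space.rank nr A + kernel.dim nc A = nc"
proof -
  interpret K: kernel nr nc A by unfold_locales (rule A)
  interpret NR: vec_space "TYPE('a)" nr .
  have *: "linear_map class_ring K.NC.V NR.V ((*\<^sub>v) A)"
  proof (intro linear_map.intro mod_hom.intro mod_hom_axioms.intro vec_vs vec_module)
    show "(*\<^sub>v) A \<in> module_hom class_ring K.NC.V NR.V"
      using A by (auto simp: module_hom_def module_vec_simps mult_add_distrib_mat_vec mult_mat_vec)
  qed
  then interpret T: linear_map class_ring K.NC.V NR.V "(*\<^sub>v) A" .
  have "T.im = NR.span (set (cols A))"
    unfolding T.im_def NR.col_space_def[symmetric] NR.col_space_eq[OF A] module_vec_simps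
    using A by auto
  moreover have "T.ker = mat_kernel A"
    using A by (auto simp: T.ker_def mat_kernel module_vec_simps)
  ultimately show ?thesis
    using T.rank_nullity[OF K.NC.fin_dim] by (simp add: NR.rank_def K.NC.dim_is_n)
qed

text \<open>The factor \<open>B\<close> leaves the kernel unchanged and \<open>C\<close> leaves its
  dimension unchanged; rank-nullity carries this over to the rank.\<close>

lemma rank_mult_invertible:
  fixes A :: "'a::field mat"
  assumes A: "A \<in> carrier_mat nr nc"
    and B: "B \<in> carrier_mat nr nr" "B' \<in> carrier_mat nr nr" "B' * B = 1\<^sub>m nr"
    and C: "C \<in> carrier_mat nc nc" "C' \<in> carrier_mat nc nc" "C * C' = 1\<^sub>m nc"
  shows "vec_space.rank nr (B * A * C) = vec_space.rank nr A"
proof -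
  have "kernel.dim nc (B * A * C) = kernel.dim nc (B * A)"
    using A B C by (intro mat_kernel_dim_mult_eq_right) auto
  also have "\<dots> = kernel.dim nc A"
    by (simp add: mat_kernel_mult_eq[OF A B])
  finally show ?thesis
    using rank_plus_kernel_dim[of "B * A * C" nr nc] rank_plus_kernel_dim[OF A] A B C by simp
qed

text \<open>The first \<open>s\<close> columns are nonzero multiples of distinct unit vectors and
  all others vanish, so these \<open>s\<close> columns form a maximal independent set of
  columns.\<close>

lemma rank_diagonal_mat:
  fixes D :: "'a::field mat"
  assumes D: "D \<in> carrier_mat nr nc" "diagonal_mat D" and s: "s \<le> nr" "s \<le> nc"
    and nz: "\<And>i. i < s \<Longrightarrow> D $$ (i, i) \<noteq> 0"
    and z: "\<And>i. s \<le> i \<Longrightarrow> i < nr \<Longrightarrow> i < nc \<Longrightarrow> D $$ (i, i) = 0"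
  shows "vec_space.rank nr D = s"
proof -
  interpret vec_space "TYPE('a)" nr .
  define U where "U = col D ` {..<s}"
  have Uc: "U \<subseteq> carrier_vec nr" using D(1) by (auto simp: U_def)
  have entry: "col D j $ i = (if i = j then D $$ (i, i) else 0)" if "i < nr" "j < nc" for i j
    using that D by (auto simp: diagonal_mat_def)
  have inj: "inj_on (col D) {..<s}"
  proof (rule inj_onI)
    fix i j assume ij: "i \<in> {..<s}" "j \<in> {..<s}" and "col D i = col D j"
    then have "col D j $ i = col D i $ i" by simp
    with ij s nz[of i] show "i = j" by (auto simp: entry split: if_splits)
  qed
  have li: "lin_indpt U"
  proof (rule finite_lin_indpt2)
    fix a assume "lincomb a U = 0\<^sub>v nr"
    \<comment> \<open>Coordinate \<open>i\<close> isolates the coefficient of column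
      \<open>i\<close>.\<close>
    moreover have "lincomb a U $ i = a (col D i) * D $$ (i, i)" if "i < s" for i
    proof -
      have "lincomb a U $ i = (\<Sum>v\<in>U. a v * v $ i)"
        using that s by (intro lincomb_index Uc) simp
      also have "\<dots> = (\<Sum>j<s. a (col D j) * col D j $ i)"
        unfolding U_def by (rule sum.reindex_cong[OF inj refl refl])
      also have "\<dots> = (\<Sum>j<s. if i = j then a (col D j) * D $$ (i, i) else 0)"
        using that s by (intro sum.cong) (simp_all add: entry)
      finally show ?thesis using that by simp
    qed
    ultimately show "\<forall>v\<in>U. a v = 0"
      using nz s by (auto simp: U_def)
  qed (use Uc in \<open>auto simp: U_def\<close>)
  have cols: "set (cols D) \<subseteq> insert (0\<^sub>v nr) U"
  proof
    fix v assume "v \<in> set (cols D)"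
    then obtain j where j: "j < nc" "v = col D j" using D by (auto simp: cols_def)
    show "v \<in> insert (0\<^sub>v nr) U"
    proof (cases "j < s")
      case False
      have "v = 0\<^sub>v nr"
      proof (rule eq_vecI)
        show "v $ i = 0\<^sub>v nr $ i" if "i < dim_vec (0\<^sub>v nr :: 'a vec)" for i
          using that j z[of i] False by (auto simp: entry)
      qed (use j D in auto)
      then show ?thesis by simp
    qed (auto simp: U_def j)
  qed
  have "maximal U (\<lambda>T. T \<subseteq> set (cols D) \<and> lin_indpt T)"
    unfolding maximal_def
  proof (intro conjI allI impI)
    show "U \<subseteq> set (cols D)" using D s by (auto simp: U_def cols_def)
    fix B assume B: "U \<subseteq> B \<and> B \<subseteq> set (cols D) \<and> lin_indpt B"
    \<comment> \<open>The zero vector is the only column outside \<open>U\<close>, and an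
      independent set cannot contain it.\<close>
    then have "0\<^sub>v nr \<notin> B"
      using vs_zero_lin_dep[of B] cols_dim[of D] D by auto
    with B cols show "B = U" by blast
  qed (rule li)
  then have "rank D = card U" by (rule rank_card_indpt[OF D(1)])
  also have "\<dots> = s" unfolding U_def by (simp add: card_image[OF inj])
  finally show ?thesis .
qed

lemma invertible_matE:
  assumes "invertible_mat A" "A \<in> carrier_mat n n"
  obtains B where "B \<in> carrier_mat n n" "A * B = 1\<^sub>m n" "B * A = 1\<^sub>m n"
proof -
  obtain B where "A * B = 1\<^sub>m (dim_row A)" "B * A = 1\<^sub>m (dim_row B)"
    using assms by (auto simp: invertible_mat_def inverts_mat_def)
  \<comment> \<open>The size of \<open>B\<close> is recovered by comparing the numbers of columns in
    the two equations.\<close>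
  moreover from this have "dim_row B = n" "dim_col B = n"
    using assms by (auto dest!: arg_cong[of _ _ dim_col])
  ultimately show thesis using that[of B] assms by auto
qed

interpretation to_fract_hom: inj_idom_hom to_fract
  by unfold_locales auto

text \<open>The point beyond unpacking is that the number of nonzero diagonal entries equals the
  rank \<open>t\<close> of \<open>K\<close> over \<open>F\<close>: the transforming matrices are
  invertible and preserve the rank. Hence the list of nonzero entries is indexed exactly like the
  diagonal up to \<open>t\<close>.\<close>

lemma smith_normal_formE:
  fixes K D :: "'a::idom mat"
  assumes K: "K \<in> carrier_mat r f" and D: "smith_normal_form K D"
  defines "t \<equiv> vec_space.rank r (map_mat to_fract K)"
  obtains B B' Q Q' where
    "B \<in> carrier_mat r r" "B' \<in> carrier_mat r r" "B' * B = 1\<^sub>m r"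
    "Q \<in> carrier_mat f f" "Q' \<in> carrier_mat f f" "Q * Q' = 1\<^sub>m f" "Q' * Q = 1\<^sub>m f"
    "B * K * Q = D" "t \<le> r" "t \<le> f"
    "\<And>i. i < t \<Longrightarrow> nonzero_diagonal D ! i = D $$ (i, i) \<and> D $$ (i, i) \<noteq> 0"
    "\<And>i j. i < r \<Longrightarrow> j < f \<Longrightarrow> D $$ (i, j) \<noteq> 0 \<Longrightarrow> i = j \<and> i < t"
proof -
  have Dc: "D \<in> carrier_mat r f" and diag: "diagonal_mat D"
    and dvd: "\<And>i. Suc i < min r f \<Longrightarrow> D $$ (i, i) dvd D $$ (Suc i, Suc i)"
    using D K by (auto simp: smith_normal_form_def)
  obtain B Q where B: "B \<in> carrier_mat r r" "invertible_mat B"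
    and Q: "Q \<in> carrier_mat f f" "invertible_mat Q" and BKQ: "B * K * Q = D"
    using D K unfolding smith_normal_form_def by auto
  obtain B' where B': "B' \<in> carrier_mat r r" "B' * B = 1\<^sub>m r" using B invertible_matE by metis
  obtain Q' where Q': "Q' \<in> carrier_mat f f" "Q * Q' = 1\<^sub>m f" "Q' * Q = 1\<^sub>m f"
    using Q invertible_matE by metis
  let ?d = "map (\<lambda>i. D $$ (i, i)) [0..<min r f]"
  obtain s where s: "s \<le> min r f" "filter (\<lambda>x. x \<noteq> 0) ?d = take s ?d"
    and nz: "\<forall>i<s. ?d ! i \<noteq> 0" and z: "\<forall>i. s \<le> i \<and> i < min r f \<longrightarrow> ?d ! i = 0"
  proof -
    have "?d ! Suc i = 0" if "Suc i < length ?d" "?d ! i = 0" for i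
      using that dvd[of i] by simp
    then show thesis using filter_nonzero_prefix[of ?d] that by auto
  qed
  let ?h = "map_mat (to_fract :: 'a \<Rightarrow> _)"
  have "vec_space.rank r (?h B * ?h K * ?h Q) = t"
    unfolding t_def
    by (rule rank_mult_invertible[of _ _ _ _ "?h B'" _ "?h Q'"])
       (use K B B' Q Q' in \<open>auto simp: to_fract_hom.mat_hom_mult[symmetric] to_fract_hom.mat_hom_one\<close>)
  also have "?h B * ?h K * ?h Q = ?h D"
    using B K Q by (simp add: BKQ[symmetric] to_fract_hom.mat_hom_mult[of _ r f _ f] to_fract_hom.mat_hom_mult[of _ r r _ f])
  also have "vec_space.rank r (?h D) = s"
    by (rule rank_diagonal_mat[of _ _ f]) (use Dc diag s nz z in \<open>auto simp: diagonal_mat_def\<close>)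
  finally have t: "t = s" by simp
  have "i = j \<and> i < t" if "i < r" "j < f" "D $$ (i, j) \<noteq> 0" for i j
    using that diag Dc z t by (auto simp: diagonal_mat_def) (metis not_less)
  moreover have "nonzero_diagonal D ! i = D $$ (i, i) \<and> D $$ (i, i) \<noteq> 0" if "i < t" for i
    using that s nz Dc t by (simp add: nonzero_diagonal_def)
  ultimately show thesis
    using that[of B B' Q Q'] B B' Q Q' BKQ s t by auto
qed

section \<open>Divisibility through gcd and lcm\<close>

text \<open>Since \<open>q\<close> divides \<open>q * x\<close> anyway, \<open>d\<close> divides it
  iff the lcm \<open>mm * q\<close> does, and \<open>q\<close> cancels. The statement for
  \<open>dd\<close> follows because \<open>mm\<close> and \<open>dd\<close> divide each
  other.\<close>

lemma dvd_mult_iff_of_gcd_lcm: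
  fixes d q :: "'a::idom"
  assumes "q \<noteq> 0" "d \<noteq> 0"
    and g: "g gcdof\<^bsub>class_ring\<^esub> d q" and l: "l lcmof\<^bsub>class_ring\<^esub> d q"
    and mm: "mm * q = l" and dd: "dd * g = d"
  shows "d dvd q * x \<longleftrightarrow> mm dvd x" and "d dvd q * x \<longleftrightarrow> dd dvd x"
proof -
  have fac: "a divides\<^bsub>class_ring\<^esub> b \<longleftrightarrow> a dvd b" for a b :: 'a
    by (simp add: factor_def dvd_def)
  have g: "g dvd d" "g dvd q" "\<And>y. y dvd d \<Longrightarrow> y dvd q \<Longrightarrow> y dvd g"
    and l: "d dvd l" "q dvd l" "\<And>y. d dvd y \<Longrightarrow> q dvd y \<Longrightarrow> l dvd y"
    using g l by (auto simp: isgcd_def islcm_def fac)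
  have *: "d dvd q * y \<longleftrightarrow> mm dvd y" for y
  proof -
    have "d dvd q * y \<longleftrightarrow> l dvd q * y"
      using l(3)[of "q * y"] dvd_trans[OF l(1)] by auto
    then show ?thesis
      using \<open>q \<noteq> 0\<close> by (simp add: mm[symmetric] mult.commute)
  qed
  have "d dvd q * dd"
    using mult_dvd_mono[OF dvd_refl g(2), of dd] by (simp add: dd mult.commute)
  then have 1: "mm dvd dd" by (simp add: *)
  \<comment> \<open>The cofactor \<open>e\<close> of \<open>mm\<close> in \<open>d\<close> will be a
    common divisor of \<open>d\<close> and \<open>q\<close>. Hence it divides \<open>g\<close>, and
    comparing \<open>mm * e\<close> with \<open>dd * g\<close> shows that \<open>dd\<close> divides
    \<open>mm\<close>.\<close>
  obtain e where e: "d = mm * e" using *[of d] by auto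
  obtain k where k: "l = d * k" using l(1) by auto
  then have "mm * q = mm * (e * k)" by (simp add: mm e ac_simps)
  moreover have "mm \<noteq> 0" using e \<open>d \<noteq> 0\<close> by auto
  ultimately have "e dvd q" by simp
  then have "e dvd g" using e by (intro g(3)) simp_all
  then obtain c where c: "g = e * c" by auto
  have "mm * e = dd * g" by (simp only: dd e[symmetric])
  also have "\<dots> = dd * c * e" by (simp add: c ac_simps)
  finally have "mm * e = dd * c * e" .
  moreover have "e \<noteq> 0" using e \<open>d \<noteq> 0\<close> by auto
  ultimately have "mm = dd * c" by simp
  then have "dd dvd mm" by simp
  with 1 show "d dvd q * x \<longleftrightarrow> dd dvd x"
    unfolding * using dvd_trans[of mm dd x] dvd_trans[of dd mm x] by auto
  show "d dvd q * x \<longleftrightarrow> mm dvd x" by (rule *)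
qed

section \<open>Nullspaces and the action of matrices\<close>

lemma submodule_fract_vec_moduleI:
  fixes Y :: "'a::idom fract vec set"
  assumes "Y \<subseteq> carrier_vec n" "0\<^sub>v n \<in> Y" "\<And>u v. u \<in> Y \<Longrightarrow> v \<in> Y \<Longrightarrow> u + v \<in> Y"
    and "\<And>a v. v \<in> Y \<Longrightarrow> to_fract a \<cdot>\<^sub>v v \<in> Y"
  shows "Module.submodule Y (class_ring :: 'a ring) (fract_vec_module n)"
proof -
  interpret Module.module "class_ring :: 'a ring" "fract_vec_module n :: ('a, 'a fract vec) module"
    by (rule module_fract_vec_module)
  have "LinearCombinations.submodule class_ring Y (fract_vec_module n)"
    using assms by unfold_locales (auto simp: fract_vec_module_def)
  then show ?thesis
    using assms(1) by (intro module_incl_imp_submodule submodule_is_module) (auto simp: fract_vec_module_def)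
qed

lemma mod_hom_mult_mat_vec:
  fixes Q :: "'a::comm_ring_1 mat"
  assumes "Q \<in> carrier_mat m n"
  shows "mod_hom class_ring (module_vec TYPE('a) n) (module_vec TYPE('a) m) ((*\<^sub>v) Q)"
  by (intro mod_hom.intro mod_hom_axioms.intro module_module_vec)
     (use assms in \<open>auto simp: module_hom_def module_vec_simps mult_add_distrib_mat_vec mult_mat_vec\<close>)

lemma mod_hom_fract_mult_mat_vec:
  fixes P :: "'a::idom fract mat"
  assumes "P \<in> carrier_mat m n"
  shows "mod_hom (class_ring :: 'a ring) (fract_vec_module n) (fract_vec_module m) ((*\<^sub>v) P)"
  by (intro mod_hom.intro mod_hom_axioms.intro module_fract_vec_module)
     (use assms in \<open>auto simp: module_hom_def fract_vec_module_def mult_add_distrib_mat_vec mult_mat_vec\<close>)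

lemma mod_hom_fract_smult_vec:
  fixes d :: "'a::idom"
  shows "mod_hom (class_ring :: 'a ring) (fract_vec_module n) (fract_vec_module n) ((\<cdot>\<^sub>v) (to_fract d))"
  by (intro mod_hom.intro mod_hom_axioms.intro module_fract_vec_module)
     (auto simp: module_hom_def fract_vec_module_def smult_add_distrib_vec smult_smult_assoc mult.commute)

lemma submodule_nullspace:
  fixes A :: "'a::idom mat"
  assumes A: "A \<in> carrier_mat m n"
  shows "Module.submodule (nullspace A) (class_ring :: 'a ring) (fract_vec_module n)"
proof (rule submodule_fract_vec_moduleI)
  show "0\<^sub>v n \<in> nullspace A"
    unfolding nullspace_def
    by (rule image_eqI[of _ _ "0\<^sub>v n"]) (use A in \<open>auto simp: mat_kernel to_fract_hom.vec_hom_zero\<close>)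
  fix u assume "u \<in> nullspace A"
  then obtain u' where u: "u = map_vec to_fract u'" "u' \<in> mat_kernel A"
    by (auto simp: nullspace_def)
  show "to_fract a \<cdot>\<^sub>v u \<in> nullspace A" for a
    unfolding nullspace_def u(1) to_fract_hom.vec_hom_smult[symmetric]
    by (intro imageI mat_kernel_smult[OF A] u(2))
  fix v assume "v \<in> nullspace A"
  then obtain v' where v: "v = map_vec to_fract v'" "v' \<in> mat_kernel A"
    by (auto simp: nullspace_def)
  show "u + v \<in> nullspace A"
    unfolding nullspace_def using u v A
    by (intro image_eqI[of _ _ "u' + v'"]) (auto simp: mat_kernel mult_add_distrib_mat_vec)
qed (use A in \<open>auto simp: nullspace_def mat_kernel\<close>)

text \<open>The entries are 0 and 1, and the inverse belongs to the inverse permutation, so both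
  matrices already live over \<open>R\<close>. Therefore \<open>P\<close> maps \<open>R^n\<close>
  onto itself.\<close>

lemma permutation_matE:
  fixes P :: "'a::idom fract mat"
  assumes "permutation_mat n P"
  obtains P0 P0' :: "'a mat" where "P0 \<in> carrier_mat n n" "P0' \<in> carrier_mat n n"
    "P = map_mat to_fract P0" "P0 * P0' = 1\<^sub>m n" "P0' * P0 = 1\<^sub>m n"
proof -
  obtain \<pi> where \<pi>: "\<pi> permutes {..<n}" and P: "P = mat n n (\<lambda>(i, j). if i = \<pi> j then 1 else 0)"
    using assms by (auto simp: permutation_mat_def)
  define M :: "(nat \<Rightarrow> nat) \<Rightarrow> 'a mat" where "M \<sigma> = mat n n (\<lambda>(i, j). if i = \<sigma> j then 1 else 0)" for \<sigma>
  have M: "M \<sigma> * M \<tau> = M (\<sigma> \<circ> \<tau>)" if "\<tau> permutes {..<n}" for \<sigma> \<tau>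
  proof (rule eq_matI)
    fix i j assume ij: "i < dim_row (M (\<sigma> \<circ> \<tau>))" "j < dim_col (M (\<sigma> \<circ> \<tau>))"
    then have j: "\<tau> j < n" using permutes_in_image[OF that, of j] by (auto simp: M_def)
    have "(M \<sigma> * M \<tau>) $$ (i, j) = (\<Sum>k = 0..<n. (if i = \<sigma> k then 1 else 0) * (if k = \<tau> j then 1 else 0))"
      using ij by (simp add: M_def scalar_prod_def)
    \<comment> \<open>Column \<open>j\<close> of the right factor has its only nonzero entry in row
      \<open>\<tau> j\<close>.\<close>
    also have "\<dots> = (\<Sum>k = 0..<n. if k = \<tau> j then if i = \<sigma> k then 1 else 0 else 0)"
      by (rule sum.cong) auto
    also have "\<dots> = M (\<sigma> \<circ> \<tau>) $$ (i, j)"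
      using ij j by (simp add: M_def)
    finally show "(M \<sigma> * M \<tau>) $$ (i, j) = M (\<sigma> \<circ> \<tau>) $$ (i, j)" .
  qed (auto simp: M_def)
  have 1: "M id = 1\<^sub>m n" by (auto simp: M_def one_mat_def)
  show thesis
  proof (rule that[of "M \<pi>" "M (inv_into UNIV \<pi>)"])
    show "P = map_mat to_fract (M \<pi>)" by (auto simp: P M_def)
    show "M \<pi> * M (inv_into UNIV \<pi>) = 1\<^sub>m n" "M (inv_into UNIV \<pi>) * M \<pi> = 1\<^sub>m n"
      using M[OF permutes_inv[OF \<pi>], of \<pi>] M[OF \<pi>, of "inv_into UNIV \<pi>"]
      by (simp_all add: permutes_inv_o[OF \<pi>] 1)
  qed (auto simp: M_def)
qed

text \<open>The factor \<open>L\<close> replaces the equations by equivalent ones, and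
  \<open>P\<close> permutes the unknowns without leaving \<open>R^n\<close>.\<close>

lemma nullspace_associated:
  fixes A Z :: "'a::idom mat" and L P :: "'a fract mat"
  assumes A: "A \<in> carrier_mat m n"
    and L: "L \<in> carrier_mat m m" "L' \<in> carrier_mat m m" "L' * L = 1\<^sub>m m"
    and P: "permutation_mat n P"
    and Z: "L * map_mat to_fract A * P = map_mat to_fract Z"
  shows "nullspace A = (*\<^sub>v) P ` nullspace Z"
proof -
  let ?v = "map_vec (to_fract :: 'a \<Rightarrow> _)" and ?m = "map_mat (to_fract :: 'a \<Rightarrow> _)"
  obtain P0 P0' where P0: "P0 \<in> carrier_mat n n" "P0' \<in> carrier_mat n n" "P = ?m P0"
    "P0 * P0' = 1\<^sub>m n" "P0' * P0 = 1\<^sub>m n"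
    using permutation_matE[OF P] .
  have "dim_row Z = dim_row (?m Z)" "dim_col Z = dim_col (?m Z)" by simp_all
  then have Zc: "Z \<in> carrier_mat m n"
    unfolding Z[symmetric] using L P0 by auto
  have ker: "v \<in> mat_kernel Z \<longleftrightarrow> P0 *\<^sub>v v \<in> mat_kernel A" if v: "v \<in> carrier_vec n" for v
  proof -
    have AP: "?m A * P \<in> carrier_mat m n" using A P0 by auto
    \<comment> \<open>The argument passes through \<open>F\<close>, where \<open>L\<close> acts, and
      returns to \<open>R\<close> by injectivity of \<open>to_fract\<close>.\<close>
    have "v \<in> mat_kernel Z \<longleftrightarrow> ?v v \<in> mat_kernel (?m Z)"
      using v Zc by (simp add: mat_kernel mat_kernel[of "?m Z" m n]
          to_fract_hom.mult_mat_vec_hom[OF Zc v, symmetric])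
    also have "?m Z = L * (?m A * P)" using Z A L P0 by simp
    also have "mat_kernel \<dots> = mat_kernel (?m A * P)"
      by (rule mat_kernel_mult_eq[OF AP L])
    also have "?m A * P = ?m (A * P0)"
      using A P0 by (simp add: to_fract_hom.mat_hom_mult[of _ m n])
    also have "?v v \<in> mat_kernel \<dots> \<longleftrightarrow> A * P0 *\<^sub>v v = 0\<^sub>v m"
      using v A P0 by (simp add: mat_kernel[of "?m (A * P0)" m n]
          to_fract_hom.mult_mat_vec_hom[of "A * P0" m n, symmetric])
    also have "\<dots> \<longleftrightarrow> P0 *\<^sub>v v \<in> mat_kernel A"
      using v A P0 by (simp add: mat_kernel)
    finally show ?thesis .
  qed
  have "mat_kernel A = (*\<^sub>v) P0 ` mat_kernel Z"
  proof (intro equalityI subsetI)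
    fix u assume u: "u \<in> mat_kernel A"
    then have uc: "u \<in> carrier_vec n" using A by (simp add: mat_kernel)
    have "P0 *\<^sub>v (P0' *\<^sub>v u) = u"
      using P0 uc by (simp flip: assoc_mult_mat_vec)
    with u uc P0 ker[of "P0' *\<^sub>v u"] show "u \<in> (*\<^sub>v) P0 ` mat_kernel Z"
      by (intro image_eqI[of _ _ "P0' *\<^sub>v u"]) auto
  qed (use ker Zc in \<open>auto simp: mat_kernel\<close>)
  moreover have "?v (P0 *\<^sub>v v) = P *\<^sub>v ?v v" if "v \<in> mat_kernel Z" for v
    using that Zc P0 by (simp add: mat_kernel to_fract_hom.mult_mat_vec_hom[of P0 n n])
  ultimately show ?thesis
    by (auto simp: nullspace_def image_image intro!: image_cong)
qed

section \<open>Solving the reduced system\<close>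

lemma mat_kernel_reduced_mat:
  assumes K: "K \<in> carrier_mat r f" and v: "v \<in> carrier_vec (r + f)"
  shows "v \<in> mat_kernel (reduced_mat m d K) \<longleftrightarrow>
    (\<forall>i<r. d * v $ i + (K *\<^sub>v vec_last v f) $ i = 0)"
proof -
  \<comment> \<open>Writing the number of rows as \<open>r + (m - r)\<close> stays correct under
    truncated subtraction, even for \<open>m < r\<close>.\<close>
  have Z: "reduced_mat m d K \<in> carrier_mat (r + (m - r)) (r + f)"
    using K by (auto simp: reduced_mat_def)
  let ?x = "vec_first v r" and ?y = "vec_last v f"
  have "reduced_mat m d K *\<^sub>v (?x @\<^sub>v ?y) =
      ((d \<cdot>\<^sub>m 1\<^sub>m r) *\<^sub>v ?x + K *\<^sub>v ?y) @\<^sub>v (0\<^sub>m (m - r) r *\<^sub>v ?x + 0\<^sub>m (m - r) f *\<^sub>v ?y)"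
    unfolding reduced_mat_def using K by (intro trans[OF four_block_mat_mult_vec]) auto
  also have "0\<^sub>m (m - r) r *\<^sub>v ?x + 0\<^sub>m (m - r) f *\<^sub>v ?y = 0\<^sub>v (m - r)"
    by (intro eq_vecI) auto
  also have "(d \<cdot>\<^sub>m 1\<^sub>m r) *\<^sub>v ?x = d \<cdot>\<^sub>v ?x"
    by (intro eq_vecI) auto
  also have "?x @\<^sub>v ?y = v" using v by simp
  finally have *: "reduced_mat m d K *\<^sub>v v = (d \<cdot>\<^sub>v ?x + K *\<^sub>v ?y) @\<^sub>v 0\<^sub>v (m - r)" .
  have "reduced_mat m d K *\<^sub>v v = 0\<^sub>v (r + (m - r)) \<longleftrightarrow> (\<forall>i<r. d * v $ i + (K *\<^sub>v ?y) $ i = 0)"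
    unfolding * using K by (auto simp: vec_eq_iff vec_first_def)
  then show ?thesis
    unfolding mat_kernel[OF Z] using v by simp
qed

text \<open>The solution of \<open>d x + K c = 0\<close> with given free part \<open>c\<close>.\<close>

definition sol_vec :: "'a::idom \<Rightarrow> 'a mat \<Rightarrow> 'a vec \<Rightarrow> 'a fract vec" where
  "sol_vec d K c = vec (dim_row K + dim_col K)
     (\<lambda>i. if i < dim_row K then - to_fract ((K *\<^sub>v c) $ i) / to_fract d
          else to_fract (c $ (i - dim_row K)))"

lemma mod_hom_sol_vec:
  fixes K :: "'a::idom mat"
  assumes K: "K \<in> carrier_mat r f"
  shows "mod_hom class_ring (module_vec TYPE('a) f) (fract_vec_module (r + f)) (sol_vec d K)"
  by (intro mod_hom.intro mod_hom_axioms.intro module_module_vec module_fract_vec_module)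
     (use K in \<open>auto simp: module_hom_def module_vec_simps fract_vec_module_def sol_vec_def
        mult_add_distrib_mat_vec mult_mat_vec add_divide_distrib diff_divide_distrib intro!: eq_vecI\<close>)

text \<open>The free part \<open>c\<close> reappears as the last \<open>f\<close>
  coordinates.\<close>

lemma sol_vec_inj:
  assumes K: "K \<in> carrier_mat r f" and "c \<in> carrier_vec f" "c' \<in> carrier_vec f"
    and "sol_vec d K c = sol_vec d K c'"
  shows "c = c'"
proof (rule eq_vecI)
  fix i assume "i < dim_vec c'"
  with assms(1-3) arg_cong[OF assms(4), of "\<lambda>v. v $ (r + i)"] show "c $ i = c' $ i"
    by (auto simp: sol_vec_def)
qed (use assms in auto)

text \<open>The vector solves the system over \<open>F\<close> by construction, so only the
  integrality of its first \<open>r\<close> coordinates is at stake.\<close>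

lemma sol_vec_in_nullspace_iff:
  fixes K :: "'a::idom mat"
  assumes K: "K \<in> carrier_mat r f" and c: "c \<in> carrier_vec f" and "d \<noteq> 0"
  shows "sol_vec d K c \<in> nullspace (reduced_mat m d K) \<longleftrightarrow> (\<forall>i<r. d dvd (K *\<^sub>v c) $ i)"
proof
  assume "sol_vec d K c \<in> nullspace (reduced_mat m d K)"
  then obtain v where v: "v \<in> mat_kernel (reduced_mat m d K)" "sol_vec d K c = map_vec to_fract v"
    by (auto simp: nullspace_def)
  have vc: "v \<in> carrier_vec (r + f)"
    using arg_cong[OF v(2), of dim_vec] K by (auto simp: sol_vec_def)
  have "vec_last v f = c"
  proof (rule eq_vecI)
    fix i assume "i < dim_vec c"
    then show "vec_last v f $ i = c $ i"
      using arg_cong[OF v(2), of "\<lambda>v. v $ (r + i)"] K c vc by (auto simp: sol_vec_def vec_last_def)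
  qed (use c in auto)
  with v mat_kernel_reduced_mat[OF K vc]
  have "d * v $ i + (K *\<^sub>v c) $ i = 0" if "i < r" for i using that by auto
  then show "\<forall>i<r. d dvd (K *\<^sub>v c) $ i"
    by (metis dvd_triv_left add.commute add_eq_0_iff dvd_minus_iff)
next
  assume dv: "\<forall>i<r. d dvd (K *\<^sub>v c) $ i"
  \<comment> \<open>The preimage over \<open>R\<close>: its first \<open>r\<close> entries are the
    negated quotients of the entries of \<open>K c\<close> by \<open>d\<close>.\<close>
  define v where "v = vec (r + f) (\<lambda>i. if i < r then - (SOME z. (K *\<^sub>v c) $ i = d * z) else c $ (i - r))"
  have z: "(K *\<^sub>v c) $ i = d * (SOME z. (K *\<^sub>v c) $ i = d * z)" if "i < r" for i
    using dv that by (metis (mono_tags, lifting) dvdE someI_ex)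
  have vc: "v \<in> carrier_vec (r + f)" by (simp add: v_def)
  have "vec_last v f = c" using c by (auto simp: vec_last_def v_def)
  then have "v \<in> mat_kernel (reduced_mat m d K)"
    using z mat_kernel_reduced_mat[OF K vc] by (auto simp: v_def)
  moreover have "sol_vec d K c = map_vec to_fract v"
  proof (rule eq_vecI)
    fix i assume "i < dim_vec (map_vec to_fract v)"
    then have i: "i < r + f" by (simp add: v_def)
    show "sol_vec d K c $ i = map_vec to_fract v $ i"
    proof (cases "i < r")
      case True
      have "to_fract ((K *\<^sub>v c) $ i) = to_fract d * to_fract (SOME z. (K *\<^sub>v c) $ i = d * z)"
        by (subst z[OF True]) simp
      with True i K \<open>d \<noteq> 0\<close> show ?thesis by (simp add: sol_vec_def v_def)
    qed (use i K in \<open>auto simp: sol_vec_def v_def\<close>)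
  qed (use K in \<open>simp add: sol_vec_def v_def\<close>)
  ultimately show "sol_vec d K c \<in> nullspace (reduced_mat m d K)"
    by (auto simp: nullspace_def)
qed

text \<open>As \<open>d\<close> is invertible in \<open>F\<close>, the first \<open>r\<close>
  coordinates of a solution are determined by the last \<open>f\<close>.\<close>

lemma nullspace_subset_sol_vec:
  fixes K :: "'a::idom mat"
  assumes K: "K \<in> carrier_mat r f" and "d \<noteq> 0"
  shows "nullspace (reduced_mat m d K) \<subseteq> sol_vec d K ` carrier_vec f"
proof
  fix u assume "u \<in> nullspace (reduced_mat m d K)"
  then obtain v where v: "v \<in> mat_kernel (reduced_mat m d K)" "u = map_vec to_fract v"
    by (auto simp: nullspace_def)
  have vc: "v \<in> carrier_vec (r + f)"
    using v(1) K by (auto simp: mat_kernel_def reduced_mat_def)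
  have "u = sol_vec d K (vec_last v f)"
  proof (rule eq_vecI)
    fix i assume "i < dim_vec (sol_vec d K (vec_last v f))"
    then have i: "i < r + f" using K by (simp add: sol_vec_def)
    show "u $ i = sol_vec d K (vec_last v f) $ i"
    proof (cases "i < r")
      case True
      then have "(K *\<^sub>v vec_last v f) $ i = - (d * v $ i)"
        using v(1) mat_kernel_reduced_mat[OF K vc] by (metis add.commute eq_neg_iff_add_eq_0)
      then show ?thesis using True i K vc \<open>d \<noteq> 0\<close> by (simp add: sol_vec_def v(2) del: index_mult_mat_vec)
    qed (use i K vc in \<open>auto simp: sol_vec_def v(2) vec_last_def\<close>)
  qed (use K vc in \<open>simp add: sol_vec_def v(2)\<close>)
  then show "u \<in> sol_vec d K ` carrier_vec f" by auto
qed

text \<open>The vector \<open>V_vec d K j\<close> is the solution with free part the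
  \<open>j\<close>-th unit vector, and by linearity the span of these is the image of all of
  \<open>R^f\<close>.\<close>

lemma span_V_vec:
  fixes K :: "'a::idom mat"
  assumes K: "K \<in> carrier_mat r f"
  shows "LinearCombinations.module.span (class_ring :: 'a ring) (fract_vec_module (r + f))
    (V_vec d K ` {..<f}) = sol_vec d K ` carrier_vec f" (is "?S = _")
proof -
  interpret sol: mod_hom class_ring "module_vec TYPE('a) f" "fract_vec_module (r + f)" "sol_vec d K"
    by (rule mod_hom_sol_vec[OF K])
  have V: "V_vec d K j = sol_vec d K (unit_vec f j)" if "j < f" for j
    using K that by (intro eq_vecI) (auto simp: V_vec_def sol_vec_def)
  have im: "sol.im = sol_vec d K ` carrier_vec f"
    by (simp add: sol.im_def module_vec_simps)
  have Vc: "V_vec d K ` {..<f} \<subseteq> carrier (fract_vec_module (r + f) :: ('a, 'a fract vec) module)"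
    using K by (auto simp: V_vec_def fract_vec_module_def)
  have S: "LinearCombinations.submodule class_ring ?S (fract_vec_module (r + f))"
    by (rule sol.N.span_is_submodule[OF Vc])
  have zero: "0\<^sub>v (r + f) \<in> ?S"
    and add: "\<And>u v. u \<in> ?S \<Longrightarrow> v \<in> ?S \<Longrightarrow> u + v \<in> ?S"
    and smult: "\<And>a v. v \<in> ?S \<Longrightarrow> to_fract a \<cdot>\<^sub>v v \<in> ?S"
    using S unfolding LinearCombinations.submodule_def by (auto simp: fract_vec_module_def)
  have sol_add: "sol_vec d K (u + v) = sol_vec d K u + sol_vec d K v"
    if "u \<in> carrier_vec f" "v \<in> carrier_vec f" for u v
    using sol.f_add[of u v] that by (simp add: module_vec_simps fract_vec_module_def)
  have sol_smult: "sol_vec d K (a \<cdot>\<^sub>v u) = to_fract a \<cdot>\<^sub>v sol_vec d K u"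
    if "u \<in> carrier_vec f" for a u
    using sol.f_smult[of a u] that by (simp add: module_vec_simps fract_vec_module_def)
  show ?thesis
  proof
    show "?S \<subseteq> sol_vec d K ` carrier_vec f"
      unfolding im[symmetric]
      by (rule sol.N.span_is_subset[OF _ sol.im_is_submodule]) (auto simp: im V)
    show "sol_vec d K ` carrier_vec f \<subseteq> ?S"
    proof clarify
      fix c :: "'a vec" assume c: "c \<in> carrier_vec f"
      \<comment> \<open>Induction over the truncations of \<open>c\<close> to its first
        \<open>k\<close> coordinates; each step adds a multiple of one spanning vector.\<close>
      have *: "sol_vec d K (vec f (\<lambda>j. if j < k then c $ j else 0)) \<in> ?S" if "k \<le> f" for k
        using that
      proof (induction k)
        case 0
        have "sol_vec d K (0\<^sub>v f) = 0\<^sub>v (r + f)"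
          using sol.f0_is_0 by (simp add: module_vec_simps fract_vec_module_def)
        then show ?case using zero by (simp add: zero_vec_def)
      next
        case (Suc k)
        have "vec f (\<lambda>j. if j < Suc k then c $ j else 0) =
            vec f (\<lambda>j. if j < k then c $ j else 0) + c $ k \<cdot>\<^sub>v unit_vec f k"
          using Suc.prems by (intro eq_vecI) (auto simp: less_Suc_eq)
        moreover have "V_vec d K k \<in> ?S"
          using subsetD[OF sol.N.in_own_span[OF Vc] imageI[of k "{..<f}"]] Suc.prems by simp
        then have "sol_vec d K (unit_vec f k) \<in> ?S"
          using Suc.prems by (simp add: V)
        ultimately show ?case
          using Suc by (simp add: sol_add sol_smult add smult)
      qed
      have "vec f (\<lambda>j. if j < f then c $ j else 0) = c"
        using c by (intro eq_vecI) auto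
      with *[of f] show "sol_vec d K c \<in> ?S" by simp
    qed
  qed
qed

text \<open>Both sides are images of \<open>R^f\<close>, and \<open>eq\<close> says that the kernels
  agree. A quotient is thus known once coordinates are found in which \<open>Y\<close> is cut out by
  separate divisibility conditions.\<close>

lemma subquotient_isomorphic_direct_sum_cyclic:
  fixes h :: "'a::comm_ring_1 vec \<Rightarrow> 'b"
  assumes h: "mod_hom class_ring (module_vec TYPE('a) f) M h"
    and Y: "Module.submodule Y class_ring M" "Y \<subseteq> h ` carrier_vec f"
    and js: "distinct js" "set js \<subseteq> {..<f}"
    and eq: "\<And>x. x \<in> carrier_vec f \<Longrightarrow> h x \<in> Y \<longleftrightarrow> (\<forall>i\<in>set js. a i dvd x $ i)"
  shows "module_isomorphic class_ring (quot_module (M\<lparr>carrier := h ` carrier_vec f\<rparr>) Y)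
    (direct_sum_list (map (\<lambda>i. cyclic_module (a i)) js))"
proof -
  have Y': "Y \<subseteq> h ` carrier (module_vec TYPE('a) f)" using Y(2) by (simp add: module_vec_simps)
  note sq = mod_hom_subquotient[OF h Y(1) Y', unfolded module_vec_simps]
  note ds = mod_hom_direct_sum_cyclic[OF js, of a]
  show ?thesis
    by (rule module_isomorphic_common_source[OF sq(1) ds(1)])
       (simp_all only: module_vec_simps sq ds eq)
qed

text \<open>Used for a matrix and for its inverse, this makes divisibility of a whole vector by
  \<open>d\<close> invariant under a change of basis over \<open>R\<close>.\<close>

lemma dvd_mult_mat_vec:
  fixes B :: "'a::comm_ring_1 mat"
  assumes "B \<in> carrier_mat m n" "v \<in> carrier_vec n" "\<And>i. i < n \<Longrightarrow> d dvd v $ i" "i < m"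
  shows "d dvd (B *\<^sub>v v) $ i"
  using assms by (auto simp: scalar_prod_def intro!: dvd_sum)

text \<open>Only the number of zero rows depends on \<open>m\<close>. Taking \<open>m' = r\<close>
  identifies the nullspaces of \<open>Z\<close> and \<open>J\<close>.\<close>

lemma mat_kernel_reduced_mat_cong:
  assumes K: "K \<in> carrier_mat r f"
  shows "mat_kernel (reduced_mat m d K) = mat_kernel (reduced_mat m' d K)"
proof -
  have "mat_kernel (reduced_mat l d K) \<subseteq> carrier_vec (r + f)" for l
    using K by (auto simp: mat_kernel_def reduced_mat_def)
  then show ?thesis using mat_kernel_reduced_mat[OF K] by blast
qed

section \<open>The chain from \<open>M\<close> through \<open>S\<close> to \<open>U\<close> and its
  quotients\<close>

theorem theorem5p1:
  fixes A Z J K D :: "'a::idom mat"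
    and L P :: "'a fract mat"
    and d :: 'a
    and m n r f t :: nat
    and S N W U M :: "'a fract vec set"
    and q :: "'a list"
    and g l mm dd :: "nat \<Rightarrow> 'a"
  assumes "principal_domain (class_ring :: 'a ring)"
    and "A \<in> carrier_mat m n"
    and "vec_space.rank m (map_mat to_fract A) = r"
    and "0 < r" and "r < n" and "f = n - r"
    and "S = nullspace A"
    and "d \<noteq> 0" and "K \<in> carrier_mat r f" and "Z = reduced_mat m d K"
    and "L \<in> carrier_mat m m" and "invertible_mat L"
    and "permutation_mat n P"
    and "L * map_mat to_fract A * P = map_mat to_fract Z"
    and "W = LinearCombinations.module.span (class_ring :: 'a ring) (fract_vec_module n) (V_vec d K ` {..<f})"
    and "J = four_block_mat (d \<cdot>\<^sub>m 1\<^sub>m r) K (0\<^sub>m 0 r) (0\<^sub>m 0 f)"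
    and "N = nullspace J"
    and "U = (\<lambda>v. P *\<^sub>v v) ` W"
    and "M = (\<lambda>v. to_fract d \<cdot>\<^sub>v v) ` U"
    and "t = vec_space.rank r (map_mat to_fract K)"
    and "smith_normal_form K D" and "q = nonzero_diagonal D"
    and "\<forall>i<t. g i gcdof\<^bsub>(class_ring :: 'a ring)\<^esub> d (q ! i)"
    and "\<forall>i<t. l i lcmof\<^bsub>(class_ring :: 'a ring)\<^esub> d (q ! i)"
    and "\<forall>i<t. mm i * q ! i = l i"
    and "\<forall>i<t. dd i * g i = d"
  shows "M \<subseteq> S \<and> S \<subseteq> U \<and>
         module_isomorphic (class_ring :: 'a ring) (sub_quot n U S) (sub_quot n W N) \<and>
         module_isomorphic (class_ring :: 'a ring) (sub_quot n W N)
           (direct_sum_list (map (\<lambda>i. cyclic_module (mm i)) (rev [0..<t]))) \<and>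
         module_isomorphic (class_ring :: 'a ring)
           (direct_sum_list (map (\<lambda>i. cyclic_module (mm i)) (rev [0..<t])))
           (direct_sum_list (map (\<lambda>i. cyclic_module (dd i)) (rev [0..<t]))) \<and>
         module_isomorphic (class_ring :: 'a ring) (sub_quot n S M)
           (sub_quot n N ((\<lambda>v. to_fract d \<cdot>\<^sub>v v) ` W)) \<and>
         module_isomorphic (class_ring :: 'a ring)
           (sub_quot n N ((\<lambda>v. to_fract d \<cdot>\<^sub>v v) ` W))
           (direct_sum_list (map (\<lambda>i. cyclic_module (g i)) [0..<t] @ replicate (f - t) (cyclic_module d)))"
proof -
  note A = assms(2) and S = assms(7) and d0 = assms(8) and K = assms(9) and P = assms(13)
  let ?R = "class_ring :: 'a ring"
  let ?E = "module_vec TYPE('a) f" and ?F = "fract_vec_module n :: ('a, 'a fract vec) module"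
  let ?d = "\<lambda>v :: 'a fract vec. to_fract d \<cdot>\<^sub>v v"
  have n: "n = r + f" using assms by simp
  obtain P0 P0' :: "'a mat" where P0: "P0 \<in> carrier_mat n n" "P0' \<in> carrier_mat n n"
    "P = map_mat to_fract P0" "P0 * P0' = 1\<^sub>m n" "P0' * P0 = 1\<^sub>m n"
    using permutation_matE[OF P] .
  have Pc: "P \<in> carrier_mat n n" using P0 by simp
  have P_inj: "u = v" if "u \<in> carrier_vec n" "v \<in> carrier_vec n" "P *\<^sub>v u = P *\<^sub>v v" for u v
  proof -
    have "map_mat to_fract P0' * P = 1\<^sub>m n"
      using P0 by (simp flip: to_fract_hom.mat_hom_mult add: to_fract_hom.mat_hom_one)
    then have "map_mat to_fract P0' *\<^sub>v (P *\<^sub>v x) = x" if "x \<in> carrier_vec n" for x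
      using that P0(2) Pc by (simp flip: assoc_mult_mat_vec)
    with that show ?thesis by metis
  qed
  have N: "N = nullspace (reduced_mat m d K)"
    using assms(16,17) K mat_kernel_reduced_mat_cong[OF K, of m d r]
    by (simp add: nullspace_def reduced_mat_def)
  obtain L' where "L' \<in> carrier_mat m m" "L' * L = 1\<^sub>m m"
    using invertible_matE assms(11,12) by metis
  then have SN: "S = (*\<^sub>v) P ` N"
    unfolding S N using nullspace_associated[OF A assms(11) _ _ P] assms(10,14) by metis
  obtain B B' Q Q' where B: "B \<in> carrier_mat r r" "B' \<in> carrier_mat r r" "B' * B = 1\<^sub>m r"
    and Q: "Q \<in> carrier_mat f f" "Q' \<in> carrier_mat f f" "Q * Q' = 1\<^sub>m f" "Q' * Q = 1\<^sub>m f"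
    and BKQ: "B * K * Q = D" and t: "t \<le> r" "t \<le> f"
    and q: "\<And>i. i < t \<Longrightarrow> q ! i = D $$ (i, i) \<and> D $$ (i, i) \<noteq> 0"
    and Dz: "\<And>i j. i < r \<Longrightarrow> j < f \<Longrightarrow> D $$ (i, j) \<noteq> 0 \<Longrightarrow> i = j \<and> i < t"
    using smith_normal_formE[OF K assms(21)] unfolding assms(20,22) by metis
  have Dc: "D \<in> carrier_mat r f" using BKQ B K Q by auto

  \<comment> \<open>Coordinates on \<open>W\<close> adapted to the Smith normal form\<close>
  define h where "h x = sol_vec d K (Q *\<^sub>v x)" for x
  have h: "mod_hom ?R ?E ?F h"
    unfolding h_def n by (rule mod_hom_comp[OF mod_hom_mult_mat_vec[OF Q(1)] mod_hom_sol_vec[OF K]])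
  have h_smult: "h (a \<cdot>\<^sub>v x) = to_fract a \<cdot>\<^sub>v h x" if "x \<in> carrier_vec f" for a x
    using module_hom_smult[OF mod_hom.f_hom[OF h], of a x] that by (simp add: module_vec_simps fract_vec_module_def)
  have h_carrier: "h x \<in> carrier_vec n" for x
    using K by (simp add: h_def sol_vec_def n)
  have h_inj: "x = y" if "x \<in> carrier_vec f" "y \<in> carrier_vec f" "h x = h y" for x y
  proof -
    have "Q *\<^sub>v x = Q *\<^sub>v y"
      using that Q by (intro sol_vec_inj[OF K]) (auto simp: h_def)
    moreover have "Q' *\<^sub>v (Q *\<^sub>v z) = z" if "z \<in> carrier_vec f" for z
      using that Q by (simp flip: assoc_mult_mat_vec)
    ultimately show ?thesis using that by metis
  qed
  have W: "W = h ` carrier_vec f"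
  proof -
    have "W = sol_vec d K ` carrier_vec f"
      unfolding assms(15) n by (rule span_V_vec[OF K])
    also have "carrier_vec f = (*\<^sub>v) Q ` carrier_vec f"
    proof (intro equalityI subsetI)
      fix c :: "'a vec" assume c: "c \<in> carrier_vec f"
      then have "c = Q *\<^sub>v (Q' *\<^sub>v c)" using Q by (simp flip: assoc_mult_mat_vec)
      with c Q show "c \<in> (*\<^sub>v) Q ` carrier_vec f" by auto
    qed (use Q in auto)
    finally show ?thesis by (simp add: h_def image_image)
  qed
  have hN: "h x \<in> N \<longleftrightarrow> (\<forall>i<t. d dvd q ! i * x $ i)" if x: "x \<in> carrier_vec f" for x
  proof -
    let ?y = "K *\<^sub>v (Q *\<^sub>v x)"
    have y: "?y \<in> carrier_vec r" using K Q x by simp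
    have By: "B *\<^sub>v ?y = D *\<^sub>v x"
      unfolding BKQ[symmetric] using B K Q x
      by (simp add: assoc_mult_mat_vec[of "B * K" r f Q f x] del: assoc_mult_mat)
    have "B' *\<^sub>v (B *\<^sub>v ?y) = ?y"
      using B y by (simp flip: assoc_mult_mat_vec)
    \<comment> \<open>Since \<open>B\<close> and \<open>B'\<close> both have entries in
      \<open>R\<close>, \<open>d\<close> divides \<open>K Q x\<close> iff it divides
      \<open>B K Q x = D x\<close>.\<close>
    then have "h x \<in> N \<longleftrightarrow> (\<forall>i<r. d dvd (D *\<^sub>v x) $ i)"
      unfolding N h_def using sol_vec_in_nullspace_iff[OF K _ d0, of "Q *\<^sub>v x"] Q x
        dvd_mult_mat_vec[OF B(1) y, of d] dvd_mult_mat_vec[OF B(2), of "D *\<^sub>v x" d] Dc By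
      by (metis mult_mat_vec_carrier)
    moreover have "(D *\<^sub>v x) $ i = (if i < t then q ! i * x $ i else 0)" if i: "i < r" for i
    proof -
      have "(D *\<^sub>v x) $ i = (\<Sum>j = 0..<f. D $$ (i, j) * x $ j)"
        using i Dc x by (simp add: scalar_prod_def)
      \<comment> \<open>Only the diagonal entry can survive, and rows from \<open>t\<close> on
        vanish.\<close>
      also have "\<dots> = (\<Sum>j = 0..<f. if j = i then if i < t then q ! i * x $ i else 0 else 0)"
        using i Dz q by (intro sum.cong) fastforce+
      finally show ?thesis using t by simp
    qed
    ultimately show ?thesis using t by auto
  qed
  have hdW: "h x \<in> ?d ` W \<longleftrightarrow> (\<forall>i<f. d dvd x $ i)" if x: "x \<in> carrier_vec f" for x
  proof
    assume "h x \<in> ?d ` W"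
    then obtain y where y: "y \<in> carrier_vec f" "h x = h (d \<cdot>\<^sub>v y)"
      by (auto simp: W h_smult)
    then have "x = d \<cdot>\<^sub>v y" using x by (intro h_inj) auto
    with y show "\<forall>i<f. d dvd x $ i" by simp
  next
    assume "\<forall>i<f. d dvd x $ i"
    then have "\<forall>i. \<exists>y. i < f \<longrightarrow> x $ i = d * y" by (auto simp: dvd_def)
    from choice[OF this] obtain z where "\<forall>i. i < f \<longrightarrow> x $ i = d * z i" ..
    then have "x = d \<cdot>\<^sub>v vec f z" using x by (intro eq_vecI) auto
    then have "h x = ?d (h (vec f z))" by (simp add: h_smult)
    then show "h x \<in> ?d ` W" by (auto simp: W)
  qed
  have gl: "g i gcdof\<^bsub>?R\<^esub> d (q ! i)" "l i lcmof\<^bsub>?R\<^esub> d (q ! i)" "mm i * q ! i = l i" "dd i * g i = d"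
    if "i < t" for i using that assms(23-26) by auto
  have mm: "d dvd q ! i * y \<longleftrightarrow> mm i dvd y" and dd: "d dvd q ! i * y \<longleftrightarrow> dd i dvd y" if "i < t" for i y
    using dvd_mult_iff_of_gcd_lcm[OF _ d0 gl[OF that]] q[OF that] by auto
  have NW: "N \<subseteq> W"
  proof -
    have "N \<subseteq> sol_vec d K ` carrier_vec f"
      unfolding N by (rule nullspace_subset_sol_vec[OF K d0])
    then show ?thesis
      unfolding assms(15) n span_V_vec[OF K] .
  qed
  \<comment> \<open>For coordinates of the form \<open>d * y\<close> the condition \<open>hN\<close>
    holds trivially.\<close>
  have dWN: "?d ` W \<subseteq> N"
    using t by (auto simp: W h_smult[symmetric] hN)
  \<comment> \<open>Scaling by \<open>d\<close> commutes with \<open>P\<close>, so \<open>M\<close>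
    is the image of \<open>d W\<close> just as \<open>S\<close> is the image of
    \<open>N\<close>.\<close>
  have M: "M = (*\<^sub>v) P ` ?d ` W"
    unfolding assms(18,19) W image_image by (intro image_cong refl) (simp add: mult_mat_vec[OF Pc h_carrier])
  have U: "U = (\<lambda>x. P *\<^sub>v h x) ` carrier_vec f"
    unfolding assms(18) W image_image ..
  have Ph: "mod_hom ?R ?E ?F (\<lambda>x. P *\<^sub>v h x)"
    by (rule mod_hom_comp[OF h mod_hom_fract_mult_mat_vec[OF Pc]])
  \<comment> \<open>Injectivity of \<open>P\<close> allows membership to be tested before applying
    \<open>P\<close>; this is what identifies the quotients of the images with those of
    \<open>W\<close> and \<open>N\<close>.\<close>
  have P_mem: "P *\<^sub>v v \<in> (*\<^sub>v) P ` Y \<longleftrightarrow> v \<in> Y" if "v \<in> carrier_vec n" "Y \<subseteq> carrier_vec n" for v Y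
    using that P_inj by blast
  have Wc: "W \<subseteq> carrier_vec n" using h_carrier by (auto simp: W)
  then have dWc: "?d ` W \<subseteq> carrier_vec n" by auto
  have subN: "Module.submodule N ?R ?F"
    unfolding N n by (rule submodule_nullspace) (use K in \<open>auto simp: reduced_mat_def\<close>)
  have subS: "Module.submodule S ?R ?F"
    unfolding S by (rule submodule_nullspace[OF A])
  have subdW: "Module.submodule (?d ` W) ?R ?F"
    using mod_hom_image_submodule[OF mod_hom_comp[OF h mod_hom_fract_smult_vec[of n d]]]
    by (simp add: W image_image module_vec_simps)
  have subM: "Module.submodule M ?R ?F"
    using mod_hom_image_submodule[OF mod_hom_comp[OF mod_hom_comp[OF h mod_hom_fract_smult_vec[of n d]]
        mod_hom_fract_mult_mat_vec[OF Pc]]]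
    by (simp add: M W image_image module_vec_simps)

  \<comment> \<open>Coordinates on \<open>N\<close>\<close>
  \<comment> \<open>By \<open>hN\<close> and \<open>dd\<close>, the image of this diagonal matrix
    consists of exactly those coordinate vectors that \<open>h\<close> sends into
    \<open>N\<close>.\<close>
  define c where "c = mat f f (\<lambda>(i, j). if i = j then if i < t then dd i else 1 else 0)"
  have cc: "c \<in> carrier_mat f f" by (simp add: c_def)
  have c_index: "(c *\<^sub>v x) $ i = (if i < t then dd i * x $ i else x $ i)"
    if "i < f" "x \<in> carrier_vec f" for i x
  proof -
    have "(c *\<^sub>v x) $ i = (\<Sum>j = 0..<f. (if i = j then if i < t then dd i else 1 else 0) * x $ j)"
      using that by (simp add: c_def scalar_prod_def)
    also have "\<dots> = (\<Sum>j = 0..<f. if i = j then (if i < t then dd i else 1) * x $ i else 0)"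
      by (rule sum.cong) auto
    finally show ?thesis using that by simp
  qed
  define k where "k x = h (c *\<^sub>v x)" for x
  have k: "mod_hom ?R ?E ?F k"
    unfolding k_def by (rule mod_hom_comp[OF mod_hom_mult_mat_vec[OF cc] h])
  have Pk: "mod_hom ?R ?E ?F (\<lambda>x. P *\<^sub>v k x)"
    by (rule mod_hom_comp[OF k mod_hom_fract_mult_mat_vec[OF Pc]])
  have N_k: "N = k ` carrier_vec f"
  proof (intro equalityI subsetI)
    fix v assume "v \<in> N"
    then obtain x where x: "x \<in> carrier_vec f" "v = h x" "h x \<in> N" using NW W by auto
    then have "\<forall>i<t. dd i dvd x $ i" using hN dd by simp
    then have "\<forall>i. \<exists>y. i < t \<longrightarrow> x $ i = dd i * y" by (auto simp: dvd_def)
    from choice[OF this] obtain z where z: "\<forall>i. i < t \<longrightarrow> x $ i = dd i * z i" ..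
    \<comment> \<open>The first \<open>t\<close> coordinates are divided by \<open>dd i\<close>; the
      remaining ones are kept.\<close>
    have "c *\<^sub>v vec f (\<lambda>i. if i < t then z i else x $ i) = x"
      by (rule eq_vecI) (use x z cc in \<open>auto simp: c_index simp del: index_mult_mat_vec\<close>)
    then have "v = k (vec f (\<lambda>i. if i < t then z i else x $ i))" by (simp add: k_def x)
    then show "v \<in> k ` carrier_vec f" by auto
  next
    fix v assume "v \<in> k ` carrier_vec f"
    then obtain x where x: "x \<in> carrier_vec f" "v = h (c *\<^sub>v x)" by (auto simp: k_def)
    have "c *\<^sub>v x \<in> carrier_vec f" using cc x by simp
    then show "v \<in> N"
      using x t by (simp add: hN dd c_index del: index_mult_mat_vec)
  qed
  have S_k: "S = (\<lambda>x. P *\<^sub>v k x) ` carrier_vec f"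
    unfolding SN N_k image_image ..
  have kdW: "k x \<in> ?d ` W \<longleftrightarrow> (\<forall>i\<in>set [0..<f]. (if i < t then g i else d) dvd x $ i)"
    if x: "x \<in> carrier_vec f" for x
  proof -
    \<comment> \<open>Cancelling \<open>dd i\<close> in \<open>d = dd i * g i\<close> leaves a
      condition modulo \<open>g i\<close> for \<open>i < t\<close>. The other \<open>f - t\<close>
      coordinates keep the condition modulo \<open>d\<close>.\<close>
    have "d dvd dd i * y \<longleftrightarrow> g i dvd y" if "i < t" for i y
    proof -
      have "dd i \<noteq> 0" using gl(4)[OF that] d0 by auto
      then show ?thesis unfolding gl(4)[OF that, symmetric] by simp
    qed
    moreover have "c *\<^sub>v x \<in> carrier_vec f" using cc x by simp
    ultimately show ?thesis
      unfolding k_def using x by (auto simp: hdW c_index simp del: index_mult_mat_vec)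
  qed
  have k_carrier: "k x \<in> carrier_vec n" for x by (simp add: k_def h_carrier)
  have MS: "M \<subseteq> S" unfolding M SN using dWN by (rule image_mono)
  have SU: "S \<subseteq> U" unfolding SN assms(18) using NW by (rule image_mono)
  note [simp] = module_vec_simps

  \<comment> \<open>The isomorphisms\<close>
  have "module_isomorphic ?R (sub_quot n U S) (sub_quot n W N)"
    using subquotients_isomorphic[OF Ph subS _ h subN] SU NW
      P_mem[OF h_carrier, of N] Wc by (simp add: U W SN)
  moreover have "module_isomorphic ?R (sub_quot n W N)
      (direct_sum_list (map (\<lambda>i. cyclic_module (mm i)) (rev [0..<t])))"
    unfolding W using NW t
    by (intro subquotient_isomorphic_direct_sum_cyclic h subN) (auto simp: W hN mm)
  moreover have "module_isomorphic ?R
      (direct_sum_list (map (\<lambda>i. cyclic_module (mm i)) (rev [0..<t])))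
      (direct_sum_list (map (\<lambda>i. cyclic_module (dd i)) (rev [0..<t])))"
  proof -
    have js: "distinct (rev [0..<t])" "set (rev [0..<t]) \<subseteq> {..<f}" using t by auto
    note ds = mod_hom_direct_sum_cyclic[OF js]
    show ?thesis
      by (rule module_isomorphic_common_source[OF ds(1) ds(1)])
         \<comment> \<open>Divisibility by \<open>mm i\<close> and by \<open>dd i\<close> are both
           equivalent to \<open>d\<close> dividing \<open>q ! i * y\<close>, so the two projections
           from \<open>R^f\<close> have the same kernel.\<close>
         (auto simp: ds(2,3) mm[symmetric] dd)
  qed
  moreover have "module_isomorphic ?R (sub_quot n S M) (sub_quot n N (?d ` W))"
    using subquotients_isomorphic[OF Pk subM _ k subdW] MS dWN
      P_mem[OF k_carrier dWc] by (simp add: S_k N_k M)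
  moreover have "module_isomorphic ?R (sub_quot n N (?d ` W))
      (direct_sum_list (map (\<lambda>i. cyclic_module (g i)) [0..<t] @ replicate (f - t) (cyclic_module d)))"
  proof -
    \<comment> \<open>The sum is rewritten as one family over all \<open>f\<close> coordinates, to
      match the conditions in \<open>kdW\<close>.\<close>
    have "map (\<lambda>i. cyclic_module (g i)) [0..<t] @ replicate (f - t) (cyclic_module d) =
        map (\<lambda>i. cyclic_module (if i < t then g i else d)) [0..<f]"
      using t by (intro nth_equalityI) (auto simp: nth_append)
    moreover have "module_isomorphic ?R (sub_quot n (k ` carrier_vec f) (?d ` W))
        (direct_sum_list (map (\<lambda>i. cyclic_module (if i < t then g i else d)) [0..<f]))"
      using dWN by (intro subquotient_isomorphic_direct_sum_cyclic k subdW kdW) (auto simp: N_k)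
    ultimately show ?thesis unfolding N_k by simp
  qed
  ultimately show ?thesis using MS SU by blast
qed

end
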